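(* Let $T=\{(x,y)\in\mathbb{R}^2: x+y>0\}$ and $\overline T=\{(x,y)\in\mathbb{R}^2: x+y\ge 0\}$, with the product order from $\mathbb{R}^2$. (i) Every pointwise finite-dimensional middle exact persistence module $M\colon T\to\mathbf{Vec}$ is isomorphic to a direct sum of modules $k_{J\cap T}$ with $J\subseteq\mathbb{R}^2$ a block and $J\cap T\neq\emptyset$. (ii) Every pointwise finite-dimensional middle exact persistence module $N\colon \overline T\to\mathbf{Vec}$ is isomorphic to a direct sum of modules $k_{J\cap \overline T}$ with $J\subseteq\mathbb{R}^2$ a block and $J\cap\overline T\ne\emptyset$.
   Context: $\mathbb{R}^2$ has the product order $(x,y)\le(x',y')$ iff $x\le x'$ and $y\le y'$. Persistence modules over a poset are functors to $k$-vector spaces with structure maps $M(p\le q)$; pointwise finite-dimensional means each $M_p$ finite-dimensional. For $Q\in\{T,\overline T\}$, a module $M\colon Q\to\mathbf{Vec}$ is middle exact if for all $x\le x'$, $y\le y'$ with $a=(x,y)$, $b=(x,y')$, $c=(x',y)$, $d=(x',y')$ all in $Q$, the sequence $M_a\xrightarrow{(M(a\le b),M(a\le c))}M_b\oplus M_c\xrightarrow{M(b\le d)-M(c\le d)}M_d$ is exact at the middle. A block in $\mathbb{R}^2$ is a non-empty subset of one of the forms: (db) $J_1\times J_2$ with $J_1,J_2\subseteq\mathbb{R}$ non-empty downward-closed; (bb) $J_1\times J_2$ with $J_1,J_2$ non-empty upward-closed; (vb) $J_1\times\mathbb{R}$ with $J_1$ a non-empty convex subset of $\mathbb{R}$; (hb)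 $\mathbb{R}\times J_2$ with $J_2$ non-empty convex. For a subset $B$ of the indexing poset, $k_B$ is $k$ on $B$, $0$ elsewhere, with identity maps between points of $B$ and zero maps otherwise. *)

theory Defs
  imports Complex_Main
begin

definition le2 :: "real \<times> real \<Rightarrow> real \<times> real \<Rightarrow> bool" where
  "le2 p q \<longleftrightarrow> fst p \<le> fst q \<and> snd p \<le> snd q"

definition T_open :: "(real \<times> real) set" where
  "T_open = {(x, y). x + y > 0}"

definition T_closed :: "(real \<times> real) set" where
  "T_closed = {(x, y). x + y \<ge> 0}"

definition down_closed :: "real set \<Rightarrow> bool" where
  "down_closed J \<longleftrightarrow> (\<forall>x\<in>J. \<forall>y. y \<le> x \<longrightarrow> y \<in> J)"

definition up_closed :: "real set \<Rightarrow> bool" where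
  "up_closed J \<longleftrightarrow> (\<forall>x\<in>J. \<forall>y. x \<le> y \<longrightarrow> y \<in> J)"

definition ord_convex :: "real set \<Rightarrow> bool" where
  "ord_convex J \<longleftrightarrow> (\<forall>a\<in>J. \<forall>b\<in>J. \<forall>c. a \<le> c \<and> c \<le> b \<longrightarrow> c \<in> J)"

definition is_block :: "(real \<times> real) set \<Rightarrow> bool" where
  "is_block B \<longleftrightarrow> B \<noteq> {} \<and>
     ((\<exists>J1 J2. J1 \<noteq> {} \<and> J2 \<noteq> {} \<and> down_closed J1 \<and> down_closed J2 \<and> B = J1 \<times> J2) \<or>
      (\<exists>J1 J2. J1 \<noteq> {} \<and> J2 \<noteq> {} \<and> up_closed J1 \<and> up_closed J2 \<and> B = J1 \<times> J2) \<or>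
      (\<exists>J1. J1 \<noteq> {} \<and> ord_convex J1 \<and> B = J1 \<times> UNIV) \<or>
      (\<exists>J2. J2 \<noteq> {} \<and> ord_convex J2 \<and> B = UNIV \<times> J2))"

definition pers_module ::
  "('k::field \<Rightarrow> 'v::ab_group_add \<Rightarrow> 'v) \<Rightarrow> (real \<times> real) set \<Rightarrow>
   (real \<times> real \<Rightarrow> 'v set) \<Rightarrow> (real \<times> real \<Rightarrow> real \<times> real \<Rightarrow> 'v \<Rightarrow> 'v) \<Rightarrow> bool" where
  "pers_module s Q V f \<longleftrightarrow>
     vector_space s \<and>
     (\<forall>p\<in>Q. module.subspace s (V p)) \<and>
     (\<forall>p\<in>Q. \<forall>q\<in>Q. le2 p q \<longrightarrow>
        (\<forall>x\<in>V p. f p q x \<in> V q) \<and>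
        (\<forall>x\<in>V p. \<forall>y\<in>V p. f p q (x + y) = f p q x + f p q y) \<and>
        (\<forall>a. \<forall>x\<in>V p. f p q (s a x) = s a (f p q x))) \<and>
     (\<forall>p\<in>Q. \<forall>x\<in>V p. f p p x = x) \<and>
     (\<forall>p\<in>Q. \<forall>q\<in>Q. \<forall>r\<in>Q. le2 p q \<and> le2 q r \<longrightarrow>
        (\<forall>x\<in>V p. f q r (f p q x) = f p r x))"

definition pointwise_fin_dim ::
  "('k::field \<Rightarrow> 'v::ab_group_add \<Rightarrow> 'v) \<Rightarrow> (real \<times> real) set \<Rightarrow>
   (real \<times> real \<Rightarrow> 'v set) \<Rightarrow> bool" where
  "pointwise_fin_dim s Q V \<longleftrightarrow>
     (\<forall>p\<in>Q. \<exists>B. finite B \<and> B \<subseteq> V p \<and> module.span s B = V p)"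

text \<open>Middle exactness: for a=(x,y), b=(x,y'), c=(x',y), d=(x',y') in Q, the
  sequence M_a \<rightarrow> M_b \<oplus> M_c \<rightarrow> M_d (second map: difference) is exact at the
  middle, i.e. the kernel of the second map equals the image of the first.\<close>

definition middle_exact ::
  "(real \<times> real) set \<Rightarrow> (real \<times> real \<Rightarrow> 'v::ab_group_add set) \<Rightarrow>
   (real \<times> real \<Rightarrow> real \<times> real \<Rightarrow> 'v \<Rightarrow> 'v) \<Rightarrow> bool" where
  "middle_exact Q V f \<longleftrightarrow>
     (\<forall>x x' y y'. x \<le> x' \<and> y \<le> y' \<and>
        (x, y) \<in> Q \<and> (x, y') \<in> Q \<and> (x', y) \<in> Q \<and> (x', y') \<in> Q \<longrightarrow>
        (\<forall>u\<in>V (x, y'). \<forall>w\<in>V (x', y).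
           (f (x, y') (x', y') u - f (x', y) (x', y') w = 0) \<longleftrightarrow>
           (\<exists>z\<in>V (x, y). f (x, y) (x, y') z = u \<and> f (x, y) (x', y) z = w)))"

text \<open>The external direct sum of the modules k_{J i \<inter> Q}, i \<in> I: at p it is the
  space of finitely supported families c : 'i \<Rightarrow> 'k supported on
  {i \<in> I. p \<in> J i \<inter> Q}; the structure map p \<le> q acts componentwise as the
  identity when q \<in> J i \<inter> Q and as zero otherwise.\<close>

definition dsum_space ::
  "(real \<times> real) set \<Rightarrow> 'i set \<Rightarrow> ('i \<Rightarrow> (real \<times> real) set) \<Rightarrow>
   real \<times> real \<Rightarrow> ('i \<Rightarrow> 'k::field) set" where
  "dsum_space Q I J p =
     {c. finite {i. c i \<noteq> 0} \<and> (\<forall>i. c i \<noteq> 0 \<longrightarrow> i \<in> I \<and> p \<in> J i \<inter> Q)}"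

definition dsum_map ::
  "(real \<times> real) set \<Rightarrow> ('i \<Rightarrow> (real \<times> real) set) \<Rightarrow>
   real \<times> real \<Rightarrow> real \<times> real \<Rightarrow> ('i \<Rightarrow> 'k::field) \<Rightarrow> ('i \<Rightarrow> 'k)" where
  "dsum_map Q J p q c = (\<lambda>i. if q \<in> J i \<inter> Q then c i else 0)"

definition iso_to_dsum ::
  "('k::field \<Rightarrow> 'v::ab_group_add \<Rightarrow> 'v) \<Rightarrow> (real \<times> real) set \<Rightarrow>
   (real \<times> real \<Rightarrow> 'v set) \<Rightarrow> (real \<times> real \<Rightarrow> real \<times> real \<Rightarrow> 'v \<Rightarrow> 'v) \<Rightarrow>
   'i set \<Rightarrow> ('i \<Rightarrow> (real \<times> real) set) \<Rightarrow> bool" where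
  "iso_to_dsum s Q V f I J \<longleftrightarrow>
     (\<exists>\<phi> :: real \<times> real \<Rightarrow> 'v \<Rightarrow> ('i \<Rightarrow> 'k).
        (\<forall>p\<in>Q. bij_betw (\<phi> p) (V p) (dsum_space Q I J p) \<and>
           (\<forall>x\<in>V p. \<forall>y\<in>V p. \<forall>i. \<phi> p (x + y) i = \<phi> p x i + \<phi> p y i) \<and>
           (\<forall>a. \<forall>x\<in>V p. \<forall>i. \<phi> p (s a x) i = a * \<phi> p x i)) \<and>
        (\<forall>p\<in>Q. \<forall>q\<in>Q. le2 p q \<longrightarrow>
           (\<forall>x\<in>V p. \<phi> q (f p q x) = dsum_map Q J p q (\<phi> p x))))"

definition block_decomposable ::
  "('k::field \<Rightarrow> 'v::ab_group_add \<Rightarrow> 'v) \<Rightarrow> (real \<times> real) set \<Rightarrow>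
   (real \<times> real \<Rightarrow> 'v set) \<Rightarrow> (real \<times> real \<Rightarrow> real \<times> real \<Rightarrow> 'v \<Rightarrow> 'v) \<Rightarrow> bool" where
  "block_decomposable s Q V f \<longleftrightarrow>
     (\<exists>(I :: (real \<times> real \<times> nat) set) J.
        (\<forall>i\<in>I. is_block (J i) \<and> J i \<inter> Q \<noteq> {}) \<and> iso_to_dsum s Q V f I J)"

end

theory Submission
  imports Defs "HOL-Library.Function_Algebras" "HOL-Library.Countable_Set"
begin

text \<open>
  By Zorn's lemma there is a maximal family of pairwise orthogonal block summands. Its common kernel
  is again pointwise finite-dimensional and middle exact, so it suffices to split one block off every
  nonzero module.

  If some vector dies both horizontally and vertically, one of least horizontal lifetime among those
  with the same vertical bound generates a death block: middle exactness lifts it downwards along the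
  whole block, compatibly by linear compactness. If there is no such vector but some vector dies
  horizontally, the horizontally dying vectors are constant in the vertical direction, and one of
  least lifetime generates a vertical band; dually for vertical death. Otherwise all maps are
  injective, and a vector in the smallest nonzero step of the filtration by how far left a vector
  comes from generates an up-closed block.

  In each case the block is directed, so the retraction is a functional on the colimit over it that
  separates the generator from everything arriving from outside the block.
\<close>

section \<open>Linear algebra\<close>

definition affine_set :: "('k::field \<Rightarrow> 'v::ab_group_add \<Rightarrow> 'v) \<Rightarrow> 'v set \<Rightarrow> bool" where
  "affine_set s A \<longleftrightarrow> (\<forall>x\<in>A. \<forall>y\<in>A. \<forall>z\<in>A. \<forall>a. x + s a (y - z) \<in> A)"

lemma affine_set_Inter: "(\<And>A. A \<in> \<A> \<Longrightarrow> affine_set s A) \<Longrightarrow> affine_set s (\<Inter>\<A>)"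
  by (auto simp: affine_set_def)

lemma affine_set_Int: "affine_set s A \<Longrightarrow> affine_set s B \<Longrightarrow> affine_set s (A \<inter> B)"
  by (auto simp: affine_set_def)

definition direction :: "'v::ab_group_add set \<Rightarrow> 'v set" where
  "direction A = {x - y |x y. x \<in> A \<and> y \<in> A}"

definition pointwise_scale :: "('k \<Rightarrow> 'v \<Rightarrow> 'v) \<Rightarrow> 'k \<Rightarrow> ('i \<Rightarrow> 'v) \<Rightarrow> 'i \<Rightarrow> 'v" where
  "pointwise_scale s a c = (\<lambda>i. s a (c i))"

lemma vector_space_pointwise:
  assumes "vector_space s"
  shows "vector_space (pointwise_scale s :: 'k::field \<Rightarrow> ('i \<Rightarrow> 'v::ab_group_add) \<Rightarrow> 'i \<Rightarrow> 'v)"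
proof -
  interpret vector_space s by fact
  show ?thesis
    by unfold_locales (auto simp: pointwise_scale_def scale_right_distrib scale_left_distrib)
qed

context vector_space
begin

lemma subspace_eqI_dim:
  assumes "finite B" "subspace S" "S \<subseteq> T" "T \<subseteq> span B" "dim T \<le> dim S"
  shows "S = T"
proof -
  obtain BS where BS: "BS \<subseteq> S" "independent BS" "S \<subseteq> span BS" "card BS = dim S"
    by (rule basis_exists)
  obtain BT where BT: "BS \<subseteq> BT" "BT \<subseteq> T" "independent BT" "T \<subseteq> span BT"
    using maximal_independent_subset_extend[OF order_trans[OF BS(1) \<open>S \<subseteq> T\<close>] BS(2)] .
  have "finite BT"
    using independent_span_bound[OF \<open>finite B\<close> BT(3)] BT(2) assms(4) by blast
  moreover have "card BT \<le> card BS"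
    using basis_card_eq_dim[OF BT(2,4,3)] BS(4) assms(5) by simp
  ultimately have "BT = BS" using card_seteq BT(1) by metis
  then have "T \<subseteq> span BS" using BT(4) by simp
  then show "S = T" using span_minimal[OF BS(1) \<open>subspace S\<close>] \<open>S \<subseteq> T\<close> by blast
qed

lemma affine_set_subspace: "subspace S \<Longrightarrow> affine_set scale S"
  by (simp add: affine_set_def subspace_add subspace_diff subspace_scale)

lemma subspace_direction:
  assumes "affine_set scale A" "A \<noteq> {}"
  shows "subspace (direction A)"
proof (rule subspaceI)
  show "0 \<in> direction A" using assms(2) by (force simp: direction_def)
next
  fix u v assume "u \<in> direction A" "v \<in> direction A"
  then obtain x y x' y' where xy: "x \<in> A" "y \<in> A" "x' \<in> A" "y' \<in> A" "u = x - y" "v = x' - y'"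
    by (auto simp: direction_def)
  have "x + scale 1 (x' - y') \<in> A" using assms(1) xy by (simp only: affine_set_def)
  then show "u + v \<in> direction A" using xy unfolding direction_def by force
next
  fix a u assume "u \<in> direction A"
  then obtain x y where xy: "x \<in> A" "y \<in> A" "u = x - y" by (auto simp: direction_def)
  then have "y + scale a (x - y) \<in> A" using assms(1) by (simp add: affine_set_def)
  then show "scale a u \<in> direction A" using xy unfolding direction_def by force
qed

lemma minimal_affine_set:
  assumes "finite B" "\<C> \<noteq> {}" and \<C>: "\<And>C. C \<in> \<C> \<Longrightarrow> affine_set scale C \<and> C \<noteq> {} \<and> C \<subseteq> span B"
  obtains C where "C \<in> \<C>" "\<And>D. D \<in> \<C> \<Longrightarrow> D \<subseteq> C \<Longrightarrow> D = C"
proof -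
  obtain C where C: "C \<in> \<C>" and least: "\<And>D. D \<in> \<C> \<Longrightarrow> dim (direction C) \<le> dim (direction D)"
    using ex_has_least_nat[of "\<lambda>C. C \<in> \<C>" _ "\<lambda>C. dim (direction C)"] assms(2) by blast
  have "C \<subseteq> D" if D: "D \<in> \<C>" "D \<subseteq> C" for D
  proof
    fix x assume "x \<in> C"
    have "direction D = direction C"
    proof (rule subspace_eqI_dim[OF \<open>finite B\<close> subspace_direction])
      show "direction D \<subseteq> direction C" using D(2) unfolding direction_def by blast
      show "direction C \<subseteq> span B" using \<C>[OF C] by (auto simp: direction_def intro: span_diff)
    qed (use \<C>[OF D(1)] least[OF D(1)] in auto)
    moreover obtain y where "y \<in> D" using \<C>[OF D(1)] by blast
    ultimately obtain u v where "u \<in> D" "v \<in> D" "x - y = u - v"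
      using \<open>x \<in> C\<close> D(2) unfolding direction_def by blast
    then have "y + scale 1 (x - y) \<in> D"
      using \<C>[OF D(1)] \<open>y \<in> D\<close> by (simp only: affine_set_def)
    then show "x \<in> D" by simp
  qed
  then show thesis by (intro that[OF C] subset_antisym)
qed

lemma least_subspace_in_chain:
  fixes D :: "'i \<Rightarrow> 'b set"
  assumes "finite B" "I \<noteq> {}" and D: "\<And>t. t \<in> I \<Longrightarrow> subspace (D t) \<and> D t \<subseteq> span B"
    and chain: "\<And>t u. t \<in> I \<Longrightarrow> u \<in> I \<Longrightarrow> D t \<subseteq> D u \<or> D u \<subseteq> D t"
  obtains t where "t \<in> I" "\<And>u. u \<in> I \<Longrightarrow> D t \<subseteq> D u"
proof -
  obtain C where "C \<in> D ` I" and minimal: "\<And>C'. C' \<in> D ` I \<Longrightarrow> C' \<subseteq> C \<Longrightarrow> C' = C"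
  proof (rule minimal_affine_set[OF \<open>finite B\<close>, of "D ` I"])
    show "affine_set scale C \<and> C \<noteq> {} \<and> C \<subseteq> span B" if "C \<in> D ` I" for C
      using that D affine_set_subspace subspace_0 by blast
  qed (use \<open>I \<noteq> {}\<close> in auto)
  then show thesis using that chain by (metis imageE imageI order_refl)
qed

lemma exists_in_least_nonzero_subspace:
  fixes D :: "'i \<Rightarrow> 'b set"
  assumes "finite B" and D: "\<And>t. subspace (D t) \<and> D t \<subseteq> span B"
    and chain: "\<And>t u. D t \<subseteq> D u \<or> D u \<subseteq> D t" and "D u \<noteq> {0}"
  obtains m where "m \<noteq> 0" "m \<in> D u" "\<And>t. m \<in> D t \<or> D t = {0}"
proof -
  obtain t where t: "D t \<noteq> {0}" and least: "\<And>u. D u \<noteq> {0} \<Longrightarrow> D t \<subseteq> D u"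
    by (rule least_subspace_in_chain[OF \<open>finite B\<close>, of "{t. D t \<noteq> {0}}" D])
      (use D chain \<open>D u \<noteq> {0}\<close> in \<open>blast+\<close>)
  obtain m where "m \<in> D t" "m \<noteq> 0" using t D subspace_0 by blast
  then show thesis using that least \<open>D u \<noteq> {0}\<close> by blast
qed

lemma subspace_Union_chain:
  assumes "\<C> \<noteq> {}" "\<And>S. S \<in> \<C> \<Longrightarrow> subspace S" "\<And>S T. S \<in> \<C> \<Longrightarrow> T \<in> \<C> \<Longrightarrow> S \<subseteq> T \<or> T \<subseteq> S"
  shows "subspace (\<Union>\<C>)"
proof (rule subspaceI)
  show "0 \<in> \<Union>\<C>" using assms(1,2) subspace_0 by blast
next
  fix x y assume "x \<in> \<Union>\<C>" "y \<in> \<Union>\<C>"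
  then obtain S where "S \<in> \<C>" "x \<in> S" "y \<in> S" using assms(3) by blast
  then show "x + y \<in> \<Union>\<C>" using assms(2) subspace_add by blast
next
  fix a x assume "x \<in> \<Union>\<C>"
  then show "scale a x \<in> \<Union>\<C>" using assms(2) subspace_scale by blast
qed

lemma separating_functional:
  assumes "subspace R" "x \<notin> R"
  obtains \<phi> where "Vector_Spaces.linear scale (*) \<phi>" "\<phi> x = 1" "\<And>y. y \<in> R \<Longrightarrow> \<phi> y = 0"
proof -
  interpret field: vector_space "(*) :: 'a \<Rightarrow> 'a \<Rightarrow> 'a"
    by unfold_locales (auto simp: algebra_simps)
  interpret vector_space_pair scale "(*) :: 'a \<Rightarrow> 'a \<Rightarrow> 'a" ..
  obtain B where B: "B \<subseteq> R" "independent B" "R \<subseteq> span B"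
    by (rule basis_exists)
  have "span B = R" using B assms by (simp add: span_subspace)
  then have "independent (insert x B)"
    using B assms by (simp add: independent_insertI)
  from linear_independent_extend[OF this, of "\<lambda>y. if y = x then 1 else 0"]
  obtain \<phi> where \<phi>: "Vector_Spaces.linear scale (*) \<phi>" "\<phi> x = 1" "\<And>y. y \<in> B \<Longrightarrow> \<phi> y = 0"
    using assms(2) B(1) by (metis insertCI subsetD)
  have "\<phi> y = 0" if "y \<in> R" for y
    by (rule linear_eq_0_on_span[OF \<phi>(1), of B]) (use \<phi>(3) that B(3) in auto)
  then show thesis using that \<phi> by blast
qed

lemma affine_set_pointwise_iff:
  "affine_set (pointwise_scale scale) A \<longleftrightarrow>
    (\<forall>c\<in>A. \<forall>d\<in>A. \<forall>e\<in>A. \<forall>a. (\<lambda>i. c i + scale a (d i - e i)) \<in> A)"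
  by (simp add: affine_set_def pointwise_scale_def plus_fun_def)

lemma affine_set_evaluation:
  assumes "affine_set (pointwise_scale scale) A"
  shows "affine_set scale ((\<lambda>c. c i) ` A)"
  unfolding affine_set_def
proof (intro ballI allI)
  fix x y z a assume "x \<in> (\<lambda>c. c i) ` A" "y \<in> (\<lambda>c. c i) ` A" "z \<in> (\<lambda>c. c i) ` A"
  then obtain c d e where cde: "c \<in> A" "d \<in> A" "e \<in> A" "x = c i" "y = d i" "z = e i" by blast
  then have "(\<lambda>j. c j + scale a (d j - e j)) \<in> A"
    using assms by (simp add: affine_set_pointwise_iff)
  from imageI[OF this, of "\<lambda>c. c i"] show "x + scale a (y - z) \<in> (\<lambda>c. c i) ` A"
    using cde by simp
qed

end

section \<open>Linear compactness\<close>

definition finite_intersection_property :: "'a set set \<Rightarrow> bool" where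
  "finite_intersection_property \<A> \<longleftrightarrow> (\<forall>\<F>. finite \<F> \<longrightarrow> \<F> \<subseteq> \<A> \<longrightarrow> \<Inter>\<F> \<noteq> {})"

lemma finite_intersection_propertyD:
  "finite_intersection_property \<A> \<Longrightarrow> finite \<F> \<Longrightarrow> \<F> \<subseteq> \<A> \<Longrightarrow> \<Inter>\<F> \<noteq> {}"
  by (simp add: finite_intersection_property_def)

lemma finite_intersection_property_Union_chain:
  assumes "\<C> \<noteq> {}" "subset.chain \<U> \<C>" "\<And>\<A>. \<A> \<in> \<C> \<Longrightarrow> finite_intersection_property \<A>"
  shows "finite_intersection_property (\<Union>\<C>)"
  unfolding finite_intersection_property_def
proof (intro allI impI)
  fix \<F> assume "finite \<F>" "\<F> \<subseteq> \<Union>\<C>"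
  then obtain \<A> where "\<A> \<in> \<C>" "\<F> \<subseteq> \<A>"
    using finite_subset_Union_chain[OF _ _ assms(1,2)] by metis
  then show "\<Inter>\<F> \<noteq> {}"
    using assms(3) \<open>finite \<F>\<close> finite_intersection_propertyD by blast
qed

lemma finite_intersection_property_antimono:
  assumes nonempty: "\<And>F. finite F \<Longrightarrow> F \<subseteq> P \<Longrightarrow> E F \<noteq> {}"
    and antimono: "\<And>F G. F \<subseteq> G \<Longrightarrow> G \<subseteq> P \<Longrightarrow> E G \<subseteq> E F"
  shows "finite_intersection_property (E ` {F. finite F \<and> F \<subseteq> P})"
  unfolding finite_intersection_property_def
proof (intro allI impI)
  fix \<F> assume "finite \<F>" "\<F> \<subseteq> E ` {F. finite F \<and> F \<subseteq> P}"
  then have "\<exists>G. finite G \<and> G \<subseteq> P \<and> E G \<subseteq> \<Inter>\<F>"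
  proof induction
    case (insert A \<F>)
    then obtain F G where "finite F" "F \<subseteq> P" "A = E F" "finite G" "G \<subseteq> P" "E G \<subseteq> \<Inter>\<F>" by auto
    then show ?case
      using antimono[of F "F \<union> G"] antimono[of G "F \<union> G"] by (intro exI[of _ "F \<union> G"]) auto
  qed auto
  then obtain G where "finite G" "G \<subseteq> P" and G: "E G \<subseteq> \<Inter>\<F>" by (elim exE conjE)
  then have "E G \<noteq> {}" by (intro nonempty)
  then show "\<Inter>\<F> \<noteq> {}" using G by auto
qed

lemma maximal_finite_intersection_property:
  assumes "\<A> \<subseteq> \<U>" "finite_intersection_property \<A>"
  obtains \<M> where "\<A> \<subseteq> \<M>" "\<M> \<subseteq> \<U>" "finite_intersection_property \<M>"
    "\<And>A. A \<in> \<U> \<Longrightarrow> finite_intersection_property (insert A \<M>) \<Longrightarrow> A \<in> \<M>"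
proof -
  let ?Z = "{\<M>. \<A> \<subseteq> \<M> \<and> \<M> \<subseteq> \<U> \<and> finite_intersection_property \<M>}"
  have "\<exists>\<M>\<in>?Z. \<forall>\<X>\<in>?Z. \<M> \<subseteq> \<X> \<longrightarrow> \<X> = \<M>"
  proof (rule subset_Zorn_nonempty)
    show "?Z \<noteq> {}" using assms by blast
    fix \<C> assume "\<C> \<noteq> {}" and chain: "subset.chain ?Z \<C>"
    then have "\<C> \<subseteq> ?Z" by (simp add: subset.chain_def)
    with \<open>\<C> \<noteq> {}\<close> have "\<A> \<subseteq> \<Union>\<C>" "\<Union>\<C> \<subseteq> \<U>" by blast+
    moreover have "finite_intersection_property (\<Union>\<C>)"
      using finite_intersection_property_Union_chain[OF \<open>\<C> \<noteq> {}\<close> chain] \<open>\<C> \<subseteq> ?Z\<close> by blast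
    ultimately show "\<Union>\<C> \<in> ?Z" by blast
  qed
  then obtain \<M> where \<M>: "\<M> \<in> ?Z" "\<forall>\<X>\<in>?Z. \<M> \<subseteq> \<X> \<longrightarrow> \<X> = \<M>" by (elim bexE)
  show thesis
  proof (rule that)
    fix A assume "A \<in> \<U>" "finite_intersection_property (insert A \<M>)"
    then have "insert A \<M> \<in> ?Z" using \<M>(1) by auto
    from bspec[OF \<M>(2) this] have "insert A \<M> = \<M>" by blast
    then show "A \<in> \<M>" by auto
  qed (use \<M>(1) in auto)
qed

context vector_space
begin

lemma least_evaluation:
  fixes \<M> :: "('i \<Rightarrow> 'b) set set"
  assumes fip: "finite_intersection_property \<M>"
    and affine: "\<And>A. A \<in> \<M> \<Longrightarrow> affine_set (pointwise_scale scale) A"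
    and A: "A \<in> \<M>" "(\<lambda>c. c i) ` A \<subseteq> span B" "finite B"
  obtains v where "\<And>\<F>. finite \<F> \<Longrightarrow> \<F> \<subseteq> \<M> \<Longrightarrow> v \<in> (\<lambda>c. c i) ` \<Inter>\<F>"
proof -
  define value_set where "value_set \<F> = (\<lambda>c. c i) ` \<Inter>(insert A \<F>)" for \<F>
  let ?\<C> = "value_set ` {\<F>. finite \<F> \<and> \<F> \<subseteq> \<M>}"
  have in_\<C>: "value_set \<F> \<in> ?\<C>" if "finite \<F>" "\<F> \<subseteq> \<M>" for \<F>
    using that by blast
  have value_set: "affine_set scale (value_set \<F>) \<and> value_set \<F> \<noteq> {} \<and> value_set \<F> \<subseteq> span B"
    if \<F>: "finite \<F>" "\<F> \<subseteq> \<M>" for \<F>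
  proof (intro conjI)
    have A\<F>: "insert A \<F> \<subseteq> \<M>" using \<F>(2) A(1) by blast
    then show "value_set \<F> \<noteq> {}"
      using finite_intersection_propertyD[OF fip, of "insert A \<F>"] \<F>(1) by (simp add: value_set_def)
    show "affine_set scale (value_set \<F>)"
      unfolding value_set_def
    proof (rule affine_set_evaluation, rule affine_set_Inter)
      show "affine_set (pointwise_scale scale) A'" if "A' \<in> insert A \<F>" for A'
        using that A\<F> by (intro affine) blast
    qed
    show "value_set \<F> \<subseteq> span B" using A(2) unfolding value_set_def by blast
  qed
  obtain C where "C \<in> ?\<C>" and minimal: "\<And>D. D \<in> ?\<C> \<Longrightarrow> D \<subseteq> C \<Longrightarrow> D = C"
  proof (rule minimal_affine_set[OF A(3)])
    show "?\<C> \<noteq> {}" using in_\<C>[of "{}"] by blast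
    show "affine_set scale C \<and> C \<noteq> {} \<and> C \<subseteq> span B" if "C \<in> ?\<C>" for C
      using that value_set by auto
  qed (rule that)
  then obtain \<G> where \<G>: "finite \<G>" "\<G> \<subseteq> \<M>" "C = value_set \<G>" by auto
  then obtain v where "v \<in> C" using value_set by blast
  have "v \<in> (\<lambda>c. c i) ` \<Inter>\<F>" if \<F>: "finite \<F>" "\<F> \<subseteq> \<M>" for \<F>
  proof -
    have "value_set (\<F> \<union> \<G>) \<in> ?\<C>" by (rule in_\<C>) (use \<F> \<G> in auto)
    moreover have "value_set (\<F> \<union> \<G>) \<subseteq> C" unfolding \<G>(3) value_set_def by blast
    ultimately have "v \<in> value_set (\<F> \<union> \<G>)"
      using minimal[of "value_set (\<F> \<union> \<G>)"] \<open>v \<in> C\<close> by simp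
    then show ?thesis unfolding value_set_def by blast
  qed
  then show thesis by (rule that)
qed

lemma maximal_affine_family_determines_value:
  fixes \<M> :: "('i \<Rightarrow> 'b) set set"
  assumes fip: "finite_intersection_property \<M>"
    and affine: "\<And>A. A \<in> \<M> \<Longrightarrow> affine_set (pointwise_scale scale) A"
    and maximal: "\<And>A. affine_set (pointwise_scale scale) A \<Longrightarrow>
      finite_intersection_property (insert A \<M>) \<Longrightarrow> A \<in> \<M>"
    and A: "A \<in> \<M>" "(\<lambda>c. c i) ` A \<subseteq> span B" "finite B"
  obtains v where "{c. c i = v} \<in> \<M>"
proof -
  obtain v where v: "\<And>\<F>. finite \<F> \<Longrightarrow> \<F> \<subseteq> \<M> \<Longrightarrow> v \<in> (\<lambda>c. c i) ` \<Inter>\<F>"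
    using least_evaluation[OF fip affine A] by blast
  have "finite_intersection_property (insert {c. c i = v} \<M>)"
    unfolding finite_intersection_property_def
  proof (intro allI impI)
    fix \<F> assume \<F>: "finite \<F>" "\<F> \<subseteq> insert {c. c i = v} \<M>"
    then have "v \<in> (\<lambda>c. c i) ` \<Inter>(\<F> - {{c. c i = v}})" by (intro v) auto
    then show "\<Inter>\<F> \<noteq> {}" by auto
  qed
  moreover have "affine_set (pointwise_scale scale) {c. c i = v}"
    by (simp add: affine_set_pointwise_iff)
  ultimately show thesis using that maximal by blast
qed

text \<open>The proof imitates that of compactness by ultrafilters: a maximal family of affine sets with
  the finite intersection property fixes the value at every coordinate.\<close>

theorem linear_compactness:
  fixes E :: "'i set \<Rightarrow> ('i \<Rightarrow> 'b) set"
  assumes affine: "\<And>F. finite F \<Longrightarrow> F \<subseteq> P \<Longrightarrow> affine_set (pointwise_scale scale) (E F)"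
    and nonempty: "\<And>F. finite F \<Longrightarrow> F \<subseteq> P \<Longrightarrow> E F \<noteq> {}"
    and antimono: "\<And>F G. F \<subseteq> G \<Longrightarrow> G \<subseteq> P \<Longrightarrow> E G \<subseteq> E F"
    and local: "\<And>F c d. F \<subseteq> P \<Longrightarrow> c \<in> E F \<Longrightarrow> (\<And>i. i \<in> F \<Longrightarrow> d i = c i) \<Longrightarrow> d \<in> E F"
    and fin_dim: "\<And>i. i \<in> P \<Longrightarrow> \<exists>B. finite B \<and> (\<lambda>c. c i) ` E {i} \<subseteq> span B"
  obtains e where "\<And>F. finite F \<Longrightarrow> F \<subseteq> P \<Longrightarrow> e \<in> E F"
proof -
  let ?\<E> = "E ` {F. finite F \<and> F \<subseteq> P}"
  have "finite_intersection_property ?\<E>"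
    by (rule finite_intersection_property_antimono[OF nonempty antimono])
  then obtain \<M> where \<M>: "?\<E> \<subseteq> \<M>" "\<M> \<subseteq> Collect (affine_set (pointwise_scale scale))"
    "finite_intersection_property \<M>" and maximal:
    "\<And>A. A \<in> Collect (affine_set (pointwise_scale scale)) \<Longrightarrow>
      finite_intersection_property (insert A \<M>) \<Longrightarrow> A \<in> \<M>"
  proof (rule maximal_finite_intersection_property[of ?\<E> "Collect (affine_set (pointwise_scale scale))",
        rotated])
    show "?\<E> \<subseteq> Collect (affine_set (pointwise_scale scale))" using affine by blast
  qed (rule that)
  have affine_\<M>: "affine_set (pointwise_scale scale) A" if "A \<in> \<M>" for A
    using that \<M>(2) by blast
  have "\<exists>v. {c. c i = v} \<in> \<M>" if "i \<in> P" for i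
  proof -
    obtain B where B: "finite B" "(\<lambda>c. c i) ` E {i} \<subseteq> span B" using fin_dim[OF \<open>i \<in> P\<close>] by blast
    have "E {i} \<in> \<M>" using that by (intro subsetD[OF \<M>(1)] imageI) simp
    from maximal_affine_family_determines_value[OF \<M>(3) affine_\<M> maximal[OF CollectI] this B(2,1)]
    show ?thesis by metis
  qed
  then obtain e where e: "\<And>i. i \<in> P \<Longrightarrow> {c. c i = e i} \<in> \<M>" by metis
  have "e \<in> E F" if F: "finite F" "F \<subseteq> P" for F
  proof -
    let ?\<F> = "insert (E F) ((\<lambda>i. {c. c i = e i}) ` F)"
    have "finite ?\<F>" "?\<F> \<subseteq> \<M>" using F e \<M>(1) by auto
    then have "\<Inter>?\<F> \<noteq> {}" by (rule finite_intersection_propertyD[OF \<M>(3)])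
    then obtain c where "c \<in> E F" "\<And>i. i \<in> F \<Longrightarrow> c i = e i" by auto
    then show ?thesis using local[OF F(2)] by simp
  qed
  then show thesis by (rule that)
qed

end

section \<open>Persistence modules over a preorder\<close>

datatype ('a, 'v, 'k) summand =
  Summand (shape: "'a set") (generator: "'a \<Rightarrow> 'v") (coordinate: "'a \<Rightarrow> 'v \<Rightarrow> 'k")

locale persistence_module = vector_space s
  for s :: "'k::field \<Rightarrow> 'v::ab_group_add \<Rightarrow> 'v" +
  fixes le :: "'a \<Rightarrow> 'a \<Rightarrow> bool" (infix \<open>\<sqsubseteq>\<close> 50) and Q :: "'a set"
    and V :: "'a \<Rightarrow> 'v set" and f :: "'a \<Rightarrow> 'a \<Rightarrow> 'v \<Rightarrow> 'v"
  assumes index_refl [simp]: "p \<sqsubseteq> p"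
    and index_trans: "p \<sqsubseteq> q \<Longrightarrow> q \<sqsubseteq> r \<Longrightarrow> p \<sqsubseteq> r"
    and upward: "p \<in> Q \<Longrightarrow> p \<sqsubseteq> q \<Longrightarrow> q \<in> Q"
    and subspace_V: "p \<in> Q \<Longrightarrow> subspace (V p)"
    and map_in: "p \<in> Q \<Longrightarrow> p \<sqsubseteq> q \<Longrightarrow> v \<in> V p \<Longrightarrow> f p q v \<in> V q"
    and map_add: "p \<in> Q \<Longrightarrow> p \<sqsubseteq> q \<Longrightarrow> v \<in> V p \<Longrightarrow> w \<in> V p \<Longrightarrow> f p q (v + w) = f p q v + f p q w"
    and map_scale: "p \<in> Q \<Longrightarrow> p \<sqsubseteq> q \<Longrightarrow> v \<in> V p \<Longrightarrow> f p q (s a v) = s a (f p q v)"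
    and map_id [simp]: "p \<in> Q \<Longrightarrow> v \<in> V p \<Longrightarrow> f p p v = v"
    and map_comp: "p \<in> Q \<Longrightarrow> p \<sqsubseteq> q \<Longrightarrow> q \<sqsubseteq> r \<Longrightarrow> v \<in> V p \<Longrightarrow> f q r (f p q v) = f p r v"
begin

lemma zero_in [simp]: "p \<in> Q \<Longrightarrow> 0 \<in> V p"
  using subspace_V subspace_0 by blast

lemma add_in: "p \<in> Q \<Longrightarrow> v \<in> V p \<Longrightarrow> w \<in> V p \<Longrightarrow> v + w \<in> V p"
  using subspace_V subspace_add by blast

lemma diff_in: "p \<in> Q \<Longrightarrow> v \<in> V p \<Longrightarrow> w \<in> V p \<Longrightarrow> v - w \<in> V p"
  using subspace_V subspace_diff by blast

lemma scale_in: "p \<in> Q \<Longrightarrow> v \<in> V p \<Longrightarrow> s a v \<in> V p"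
  using subspace_V subspace_scale by blast

lemma map_zero [simp]: "p \<in> Q \<Longrightarrow> p \<sqsubseteq> q \<Longrightarrow> f p q 0 = 0"
  using map_add[of p q 0 0] by simp

lemma map_diff: "p \<in> Q \<Longrightarrow> p \<sqsubseteq> q \<Longrightarrow> v \<in> V p \<Longrightarrow> w \<in> V p \<Longrightarrow> f p q (v - w) = f p q v - f p q w"
  using map_add[of p q "v - w" w] diff_in[of p v w] by simp

lemma map_sum: "p \<in> Q \<Longrightarrow> p \<sqsubseteq> q \<Longrightarrow> (\<And>i. i \<in> A \<Longrightarrow> g i \<in> V p) \<Longrightarrow>
    f p q (\<Sum>i\<in>A. g i) = (\<Sum>i\<in>A. f p q (g i))"
  by (induction A rule: infinite_finite_induct) (auto simp: map_add subspace_V subspace_sum)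

lemma map_square:
  "p \<in> Q \<Longrightarrow> p \<sqsubseteq> q \<Longrightarrow> q \<sqsubseteq> t \<Longrightarrow> p \<sqsubseteq> r \<Longrightarrow> r \<sqsubseteq> t \<Longrightarrow> v \<in> V p \<Longrightarrow> f q t (f p q v) = f r t (f p r v)"
  by (simp add: map_comp)

lemma subspace_map_image:
  assumes "p \<in> Q" "p \<sqsubseteq> q"
  shows "subspace (f p q ` V p)"
proof (rule subspaceI)
  show "0 \<in> f p q ` V p" using assms map_zero zero_in by (metis imageI)
next
  fix v w assume "v \<in> f p q ` V p" "w \<in> f p q ` V p"
  then show "v + w \<in> f p q ` V p"
    using add_in[OF assms(1)] by (auto simp: map_add[OF assms, symmetric])
next
  fix a v assume "v \<in> f p q ` V p"
  then show "s a v \<in> f p q ` V p"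
    using scale_in[OF assms(1)] by (auto simp: map_scale[OF assms, symmetric])
qed

definition kernel :: "'a \<Rightarrow> 'a \<Rightarrow> 'v set" where
  "kernel p q = {v \<in> V p. f p q v = 0}"

lemma kernel_subset: "kernel p q \<subseteq> V p"
  by (auto simp: kernel_def)

lemma subspace_kernel: "p \<in> Q \<Longrightarrow> p \<sqsubseteq> q \<Longrightarrow> subspace (kernel p q)"
  by (rule subspaceI) (auto simp: kernel_def add_in scale_in map_add map_scale)

lemma kernel_mono: "p \<in> Q \<Longrightarrow> p \<sqsubseteq> q \<Longrightarrow> q \<sqsubseteq> r \<Longrightarrow> kernel p q \<subseteq> kernel p r"
  using upward[of p q] by (auto simp: kernel_def map_comp[symmetric, of p q r])

definition submodule :: "('a \<Rightarrow> 'v set) \<Rightarrow> bool" where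
  "submodule S \<longleftrightarrow> (\<forall>q\<in>Q. subspace (S q) \<and> S q \<subseteq> V q \<and> (\<forall>r. q \<sqsubseteq> r \<longrightarrow> f q r ` S q \<subseteq> S r))"

lemma submodule_subspace: "submodule S \<Longrightarrow> q \<in> Q \<Longrightarrow> subspace (S q)"
  by (simp add: submodule_def)

lemma submodule_in: "submodule S \<Longrightarrow> q \<in> Q \<Longrightarrow> v \<in> S q \<Longrightarrow> v \<in> V q"
  by (auto simp: submodule_def)

lemma submodule_map: "submodule S \<Longrightarrow> q \<in> Q \<Longrightarrow> q \<sqsubseteq> r \<Longrightarrow> v \<in> S q \<Longrightarrow> f q r v \<in> S r"
  unfolding submodule_def by blast

lemma persistence_module_submodule:
  assumes "submodule S"
  shows "persistence_module s (\<sqsubseteq>) Q S f"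
proof unfold_locales
  show "subspace (S p)" if "p \<in> Q" for p by (rule submodule_subspace[OF assms that])
  show "f p q v \<in> S q" if "p \<in> Q" "p \<sqsubseteq> q" "v \<in> S p" for p q v
    by (rule submodule_map[OF assms that])
qed (use submodule_in[OF assms] in \<open>auto simp: map_add map_scale map_comp intro: index_trans upward\<close>)

definition coherent :: "('a \<Rightarrow> 'v set) \<Rightarrow> 'a set \<Rightarrow> ('a \<Rightarrow> 'v) \<Rightarrow> bool" where
  "coherent S F e \<longleftrightarrow> (\<forall>q\<in>F. e q \<in> S q) \<and> (\<forall>q\<in>F. \<forall>r\<in>F. q \<sqsubseteq> r \<longrightarrow> f q r (e q) = e r)"

lemma coherent_in: "coherent S F e \<Longrightarrow> q \<in> F \<Longrightarrow> e q \<in> S q"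
  by (simp add: coherent_def)

lemma coherent_map: "coherent S F e \<Longrightarrow> q \<in> F \<Longrightarrow> r \<in> F \<Longrightarrow> q \<sqsubseteq> r \<Longrightarrow> f q r (e q) = e r"
  by (simp add: coherent_def)

lemma coherent_subset: "coherent S G e \<Longrightarrow> F \<subseteq> G \<Longrightarrow> coherent S F e"
  unfolding coherent_def by blast

lemma affine_set_coherent:
  assumes S: "submodule S" and "F \<subseteq> Q"
  shows "affine_set (pointwise_scale s) {e. coherent S F e}"
  unfolding affine_set_pointwise_iff
proof (intro ballI allI, unfold mem_Collect_eq)
  fix c d e a assume cde: "coherent S F c" "coherent S F d" "coherent S F e"
  have "c q + s a (d q - e q) \<in> S q" if "q \<in> F" for q
  proof -
    have "subspace (S q)" using submodule_subspace[OF S] that \<open>F \<subseteq> Q\<close> by blast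
    then show ?thesis
      using cde that by (simp add: coherent_in subspace_add subspace_scale subspace_diff)
  qed
  moreover have "f q r (c q + s a (d q - e q)) = c r + s a (d r - e r)"
    if qr: "q \<in> F" "r \<in> F" "q \<sqsubseteq> r" for q r
  proof -
    have "q \<in> Q" using qr \<open>F \<subseteq> Q\<close> by blast
    then have "c q \<in> V q" "d q \<in> V q" "e q \<in> V q"
      using submodule_in[OF S] cde qr(1) by (simp_all add: coherent_in)
    then have "f q r (c q + s a (d q - e q)) = f q r (c q) + s a (f q r (d q) - f q r (e q))"
      using \<open>q \<in> Q\<close> qr(3) by (simp add: map_add map_scale map_diff diff_in scale_in)
    then show ?thesis using qr cde by (simp add: coherent_map)
  qed
  ultimately show "coherent S F (\<lambda>q. c q + s a (d q - e q))"
    by (simp add: coherent_def)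
qed

definition dying_outside :: "'a set \<Rightarrow> 'a \<Rightarrow> 'v set" where
  "dying_outside J q = {v \<in> V q. \<forall>r. q \<sqsubseteq> r \<longrightarrow> r \<notin> J \<longrightarrow> f q r v = 0}"

lemma dying_outside_in: "v \<in> dying_outside J q \<Longrightarrow> v \<in> V q"
  by (simp add: dying_outside_def)

lemma dying_outsideD: "v \<in> dying_outside J q \<Longrightarrow> q \<sqsubseteq> r \<Longrightarrow> r \<notin> J \<Longrightarrow> f q r v = 0"
  by (simp add: dying_outside_def)

lemma submodule_dying_outside: "submodule (dying_outside J)"
  unfolding submodule_def
proof (intro ballI conjI allI impI)
  fix q assume q: "q \<in> Q"
  show "subspace (dying_outside J q)"
    by (rule subspaceI) (use q in \<open>auto simp: dying_outside_def add_in scale_in map_add map_scale\<close>)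
  show "dying_outside J q \<subseteq> V q" using dying_outside_in by blast
  show "f q r ` dying_outside J q \<subseteq> dying_outside J r" if "q \<sqsubseteq> r" for r
    using q that index_trans[OF that] by (auto simp: dying_outside_def map_in map_comp)
qed

definition from_outside :: "'a set \<Rightarrow> 'a \<Rightarrow> 'v set" where
  "from_outside J r = span (\<Union>q\<in>{q \<in> Q - J. q \<sqsubseteq> r}. f q r ` V q)"

lemma from_outside_map_in: "q \<in> Q - J \<Longrightarrow> q \<sqsubseteq> r \<Longrightarrow> v \<in> V q \<Longrightarrow> f q r v \<in> from_outside J r"
  unfolding from_outside_def by (rule span_base) blast

lemma submodule_from_outside: "submodule (from_outside J)"
  unfolding submodule_def
proof (intro ballI conjI allI impI)
  fix q assume q: "q \<in> Q"
  show "subspace (from_outside J q)" by (simp add: from_outside_def)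
  show "from_outside J q \<subseteq> V q"
    unfolding from_outside_def by (rule span_minimal[OF _ subspace_V[OF q]]) (use map_in in blast)
  fix r assume "q \<sqsubseteq> r"
  let ?preimage = "{v \<in> V q. f q r v \<in> from_outside J r}"
  have "subspace ?preimage"
    using q \<open>q \<sqsubseteq> r\<close> by (intro subspaceI)
      (auto simp: add_in scale_in map_add map_scale from_outside_def span_zero span_add span_scale)
  moreover have "(\<Union>p\<in>{p \<in> Q - J. p \<sqsubseteq> q}. f p q ` V p) \<subseteq> ?preimage"
  proof safe
    fix p v assume p: "p \<in> Q" "p \<notin> J" "p \<sqsubseteq> q" "v \<in> V p"
    show "f p q v \<in> V q" using p by (intro map_in)
    have "f p r v \<in> from_outside J r"
      using p \<open>q \<sqsubseteq> r\<close> by (intro from_outside_map_in) (auto intro: index_trans)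
    then show "f q r (f p q v) \<in> from_outside J r" using p \<open>q \<sqsubseteq> r\<close> by (simp add: map_comp)
  qed
  ultimately have "from_outside J q \<subseteq> ?preimage"
    unfolding from_outside_def[of J q] by (rule span_minimal[rotated])
  then show "f q r ` from_outside J q \<subseteq> from_outside J r" by blast
qed

lemma from_outside_down_closed:
  assumes "\<And>q. q \<in> Q \<Longrightarrow> q \<sqsubseteq> r \<Longrightarrow> q \<in> J"
  shows "from_outside J r = {0}"
proof -
  have no_source: "{q \<in> Q - J. q \<sqsubseteq> r} = {}" using assms by blast
  show ?thesis by (simp only: from_outside_def no_source) simp
qed

text \<open>The colimit of \<open>V/L\<close> over a directed set \<open>D\<close> is realised inside the space of all functions
  modulo those that eventually take values in \<open>L\<close>: a vector is represented by its forward orbit.\<close>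

definition eventually_in :: "('a \<Rightarrow> 'v set) \<Rightarrow> 'a set \<Rightarrow> ('a \<Rightarrow> 'v) set" where
  "eventually_in L D = {c. \<exists>q\<in>D. \<forall>r\<in>D. q \<sqsubseteq> r \<longrightarrow> c r \<in> L r}"

definition orbit :: "'a \<Rightarrow> 'v \<Rightarrow> 'a \<Rightarrow> 'v" where
  "orbit q v r = (if q \<sqsubseteq> r then f q r v else 0)"

lemma eventually_inI: "q \<in> D \<Longrightarrow> (\<And>r. r \<in> D \<Longrightarrow> q \<sqsubseteq> r \<Longrightarrow> c r \<in> L r) \<Longrightarrow> c \<in> eventually_in L D"
  by (auto simp: eventually_in_def)

lemma orbit_add:
  "q \<in> Q \<Longrightarrow> v \<in> V q \<Longrightarrow> w \<in> V q \<Longrightarrow> orbit q (v + w) = orbit q v + orbit q w"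
  by (auto simp: orbit_def fun_eq_iff map_add)

lemma orbit_scale: "q \<in> Q \<Longrightarrow> v \<in> V q \<Longrightarrow> orbit q (s a v) = pointwise_scale s a (orbit q v)"
  by (auto simp: orbit_def pointwise_scale_def fun_eq_iff map_scale)

context
  fixes D :: "'a set" and L :: "'a \<Rightarrow> 'v set"
  assumes D: "D \<subseteq> Q" and directed: "\<And>q r. q \<in> D \<Longrightarrow> r \<in> D \<Longrightarrow> \<exists>t\<in>D. q \<sqsubseteq> t \<and> r \<sqsubseteq> t"
    and L: "submodule L"
begin

lemma subspace_at: "r \<in> D \<Longrightarrow> subspace (L r)"
  using submodule_subspace[OF L] D by blast

lemma subspace_eventually_in:
  assumes "D \<noteq> {}"
  shows "module.subspace (pointwise_scale s) (eventually_in L D)"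
proof -
  interpret pointwise: vector_space "pointwise_scale s :: 'k \<Rightarrow> ('a \<Rightarrow> 'v) \<Rightarrow> 'a \<Rightarrow> 'v"
    by (rule vector_space_pointwise) (rule vector_space_axioms)
  show ?thesis
  proof (rule pointwise.subspaceI)
    show "0 \<in> eventually_in L D"
      unfolding eventually_in_def using assms subspace_at subspace_0 by (auto simp: zero_fun_def)
  next
    fix c d assume "c \<in> eventually_in L D" "d \<in> eventually_in L D"
    then obtain q r where q: "q \<in> D" "\<And>t. t \<in> D \<Longrightarrow> q \<sqsubseteq> t \<Longrightarrow> c t \<in> L t"
      and r: "r \<in> D" "\<And>t. t \<in> D \<Longrightarrow> r \<sqsubseteq> t \<Longrightarrow> d t \<in> L t" by (auto simp: eventually_in_def)
    obtain u where u: "u \<in> D" "q \<sqsubseteq> u" "r \<sqsubseteq> u" using directed q(1) r(1) by blast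
    have "(c + d) t \<in> L t" if "t \<in> D" "u \<sqsubseteq> t" for t
      using q(2) r(2) that subspace_at u by (auto intro: subspace_add index_trans)
    then show "c + d \<in> eventually_in L D" by (rule eventually_inI[OF u(1)])
  next
    fix a c assume "c \<in> eventually_in L D"
    then show "pointwise_scale s a c \<in> eventually_in L D"
      unfolding eventually_in_def pointwise_scale_def using subspace_at subspace_scale by blast
  qed
qed

lemma orbit_eventually_in: "q \<in> D \<Longrightarrow> v \<in> L q \<Longrightarrow> orbit q v \<in> eventually_in L D"
  using D submodule_map[OF L] by (intro eventually_inI[of q]) (auto simp: orbit_def)

lemma orbit_map_diff_eventually_in:
  assumes "q \<in> D" "r \<in> D" "q \<sqsubseteq> r" "v \<in> V q"
  shows "orbit r (f q r v) - orbit q v \<in> eventually_in L D"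
proof (rule eventually_inI[OF assms(2)])
  show "(orbit r (f q r v) - orbit q v) t \<in> L t" if "t \<in> D" "r \<sqsubseteq> t" for t
    using assms D that index_trans[of q r t] subspace_0[OF subspace_at[of t]]
    by (auto simp: orbit_def map_comp)
qed

lemma orbit_not_eventually_in:
  assumes "p \<in> D" and "\<And>r. r \<in> D \<Longrightarrow> p \<sqsubseteq> r \<Longrightarrow> f p r m \<notin> L r"
  shows "orbit p m \<notin> eventually_in L D"
proof
  assume "orbit p m \<in> eventually_in L D"
  then obtain q where q: "q \<in> D" "\<And>r. r \<in> D \<Longrightarrow> q \<sqsubseteq> r \<Longrightarrow> orbit p m r \<in> L r"
    by (auto simp: eventually_in_def)
  obtain t where t: "t \<in> D" "p \<sqsubseteq> t" "q \<sqsubseteq> t" using directed assms(1) q(1) by blast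
  then show False using q(2)[of t] assms(2)[of t] by (simp add: orbit_def)
qed

lemma functional_on_directed_colimit:
  assumes p: "p \<in> D" and m: "\<And>r. r \<in> D \<Longrightarrow> p \<sqsubseteq> r \<Longrightarrow> f p r m \<notin> L r"
  obtains \<phi> where "\<And>q v w. q \<in> D \<Longrightarrow> v \<in> V q \<Longrightarrow> w \<in> V q \<Longrightarrow> \<phi> q (v + w) = \<phi> q v + \<phi> q w"
    "\<And>q a v. q \<in> D \<Longrightarrow> v \<in> V q \<Longrightarrow> \<phi> q (s a v) = a * \<phi> q v"
    "\<And>q r v. q \<in> D \<Longrightarrow> r \<in> D \<Longrightarrow> q \<sqsubseteq> r \<Longrightarrow> v \<in> V q \<Longrightarrow> \<phi> r (f q r v) = \<phi> q v"
    "\<And>q v. q \<in> D \<Longrightarrow> v \<in> L q \<Longrightarrow> \<phi> q v = 0" "\<phi> p m = (1 :: 'k)"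
proof -
  interpret pointwise: vector_space "pointwise_scale s :: 'k \<Rightarrow> ('a \<Rightarrow> 'v) \<Rightarrow> 'a \<Rightarrow> 'v"
    by (rule vector_space_pointwise) (rule vector_space_axioms)
  have "D \<noteq> {}" using p by blast
  from pointwise.separating_functional[OF subspace_eventually_in[OF this] orbit_not_eventually_in[OF p m]]
  obtain \<psi> where linear: "Vector_Spaces.linear (pointwise_scale s) (*) \<psi>"
    and \<psi>: "\<psi> (orbit p m) = 1" "\<And>c. c \<in> eventually_in L D \<Longrightarrow> \<psi> c = 0" by blast
  interpret \<psi>: Vector_Spaces.linear "pointwise_scale s" "(*)" \<psi> by (rule linear)
  show thesis
  proof (rule that[of "\<lambda>q v. \<psi> (orbit q v)"])
    fix q v assume q: "q \<in> D" and v: "v \<in> V q"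
    then have "q \<in> Q" using D by blast
    show "\<psi> (orbit q (v + w)) = \<psi> (orbit q v) + \<psi> (orbit q w)" if "w \<in> V q" for w
      using that v \<open>q \<in> Q\<close> by (simp add: orbit_add \<psi>.add)
    show "\<psi> (orbit q (s a v)) = a * \<psi> (orbit q v)" for a
      using v \<open>q \<in> Q\<close> by (simp add: orbit_scale \<psi>.scale)
    show "\<psi> (orbit r (f q r v)) = \<psi> (orbit q v)" if "r \<in> D" "q \<sqsubseteq> r" for r
      using \<psi>(2)[OF orbit_map_diff_eventually_in[OF q that v]] by (simp add: \<psi>.diff)
  next
    show "\<psi> (orbit q v) = 0" if "q \<in> D" "v \<in> L q" for q v
      using \<psi>(2) orbit_eventually_in that by blast
  qed (rule \<psi>(1))
qed

end

text \<open>A summand isomorphic to \<open>k\<^bsub>J \<inter> Q\<^esub>\<close> is given by the inclusion, which sends \<open>1\<close> at \<open>p\<close> to the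
  generator, and the retraction, the coordinate.\<close>

definition is_summand :: "('a, 'v, 'k) summand \<Rightarrow> bool" where
  "is_summand t \<longleftrightarrow>
    (\<forall>p\<in>Q. generator t p \<in> V p \<and>
       (\<forall>v\<in>V p. \<forall>w\<in>V p. coordinate t p (v + w) = coordinate t p v + coordinate t p w) \<and>
       (\<forall>a. \<forall>v\<in>V p. coordinate t p (s a v) = a * coordinate t p v)) \<and>
    (\<forall>p\<in>Q - shape t. generator t p = 0 \<and> (\<forall>v\<in>V p. coordinate t p v = 0)) \<and>
    (\<forall>p\<in>Q \<inter> shape t. coordinate t p (generator t p) = 1) \<and>
    (\<forall>p\<in>Q. \<forall>q. p \<sqsubseteq> q \<longrightarrow> (p \<in> shape t \<longrightarrow> f p q (generator t p) = generator t q) \<and>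
       (q \<in> shape t \<longrightarrow> (\<forall>v\<in>V p. coordinate t q (f p q v) = coordinate t p v)))"

context
  fixes t :: "('a, 'v, 'k) summand"
  assumes t: "is_summand t"
begin

lemma generator_in: "p \<in> Q \<Longrightarrow> generator t p \<in> V p"
  using t by (simp add: is_summand_def)

lemma generator_out: "p \<in> Q \<Longrightarrow> p \<notin> shape t \<Longrightarrow> generator t p = 0"
  using t by (simp add: is_summand_def)

lemma map_generator: "p \<in> Q \<Longrightarrow> p \<sqsubseteq> q \<Longrightarrow> p \<in> shape t \<Longrightarrow> f p q (generator t p) = generator t q"
  using t by (simp add: is_summand_def)

lemma coordinate_generator: "p \<in> Q \<Longrightarrow> p \<in> shape t \<Longrightarrow> coordinate t p (generator t p) = 1"
  using t by (simp add: is_summand_def)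

lemma coordinate_out: "p \<in> Q \<Longrightarrow> p \<notin> shape t \<Longrightarrow> v \<in> V p \<Longrightarrow> coordinate t p v = 0"
  using t by (simp add: is_summand_def)

lemma coordinate_add:
  "p \<in> Q \<Longrightarrow> v \<in> V p \<Longrightarrow> w \<in> V p \<Longrightarrow> coordinate t p (v + w) = coordinate t p v + coordinate t p w"
  using t by (simp add: is_summand_def)

lemma coordinate_scale: "p \<in> Q \<Longrightarrow> v \<in> V p \<Longrightarrow> coordinate t p (s a v) = a * coordinate t p v"
  using t by (simp add: is_summand_def)

lemma coordinate_map:
  "p \<in> Q \<Longrightarrow> p \<sqsubseteq> q \<Longrightarrow> q \<in> shape t \<Longrightarrow> v \<in> V p \<Longrightarrow> coordinate t q (f p q v) = coordinate t p v"
  using t by (simp add: is_summand_def)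

lemma coordinate_zero: "p \<in> Q \<Longrightarrow> coordinate t p 0 = 0"
  using coordinate_scale[of p 0 0] by simp

lemma coordinate_diff:
  "p \<in> Q \<Longrightarrow> v \<in> V p \<Longrightarrow> w \<in> V p \<Longrightarrow> coordinate t p (v - w) = coordinate t p v - coordinate t p w"
  using coordinate_add[of p "v - w" w] diff_in[of p v w] by simp

lemma coordinate_sum:
  assumes "p \<in> Q" "\<And>i. i \<in> A \<Longrightarrow> g i \<in> V p"
  shows "coordinate t p (\<Sum>i\<in>A. g i) = (\<Sum>i\<in>A. coordinate t p (g i))"
  using assms(2)
  by (induction A rule: infinite_finite_induct)
    (auto simp: coordinate_zero coordinate_add assms(1) subspace_V subspace_sum)

end

lemma summand_if_not_from_outside:
  assumes p: "p \<in> J \<inter> Q" and directed: "\<And>q r. q \<in> J \<inter> Q \<Longrightarrow> r \<in> J \<inter> Q \<Longrightarrow> \<exists>t\<in>J \<inter> Q. q \<sqsubseteq> t \<and> r \<sqsubseteq> t"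
    and e: "coherent V (J \<inter> Q) e" and dies: "\<And>q r. q \<in> J \<inter> Q \<Longrightarrow> q \<sqsubseteq> r \<Longrightarrow> r \<notin> J \<Longrightarrow> f q r (e q) = 0"
    and lives: "\<And>r. r \<in> J \<Longrightarrow> p \<sqsubseteq> r \<Longrightarrow> f p r (e p) \<notin> from_outside J r"
  obtains t where "is_summand t" "shape t = J"
proof -
  obtain \<phi> where add: "\<And>q v w. q \<in> J \<inter> Q \<Longrightarrow> v \<in> V q \<Longrightarrow> w \<in> V q \<Longrightarrow> \<phi> q (v + w) = \<phi> q v + \<phi> q w"
    and scale: "\<And>q a v. q \<in> J \<inter> Q \<Longrightarrow> v \<in> V q \<Longrightarrow> \<phi> q (s a v) = a * \<phi> q v"
    and natural: "\<And>q r v. q \<in> J \<inter> Q \<Longrightarrow> r \<in> J \<inter> Q \<Longrightarrow> q \<sqsubseteq> r \<Longrightarrow> v \<in> V q \<Longrightarrow> \<phi> r (f q r v) = \<phi> q v"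
    and vanishes: "\<And>q v. q \<in> J \<inter> Q \<Longrightarrow> v \<in> from_outside J q \<Longrightarrow> \<phi> q v = 0" and one: "\<phi> p (e p) = (1 :: 'k)"
    by (rule functional_on_directed_colimit[OF _ directed submodule_from_outside p]) (use lives in auto)
  let ?t = "Summand J (\<lambda>q. if q \<in> J then e q else 0) (\<lambda>q v. if q \<in> J then \<phi> q v else 0)"
  have unit: "\<phi> q (e q) = 1" if q: "q \<in> J \<inter> Q" for q
  proof -
    obtain r where r: "r \<in> J \<inter> Q" "p \<sqsubseteq> r" "q \<sqsubseteq> r" using directed[OF p q] by blast
    have "\<phi> p (e p) = \<phi> r (e r)"
      using natural[OF p r(1,2), of "e p"] coherent_in[OF e p] coherent_map[OF e p r(1,2)] by simp
    also have "\<dots> = \<phi> q (e q)"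
      using natural[OF q r(1,3), of "e q"] coherent_in[OF e q] coherent_map[OF e q r(1,3)] by simp
    finally show ?thesis using one by simp
  qed
  have "is_summand ?t"
    unfolding is_summand_def
  proof (intro conjI ballI allI impI)
    fix q r assume q: "q \<in> Q" "q \<sqsubseteq> r"
    then have "r \<in> Q" by (rule upward)
    then show "f q r (generator ?t q) = generator ?t r" if "q \<in> shape ?t"
      using that q dies[of q r] coherent_map[OF e, of q r] by simp
    show "coordinate ?t r (f q r v) = coordinate ?t q v" if "r \<in> shape ?t" "v \<in> V q" for v
      using that q \<open>r \<in> Q\<close> natural[of q r v] vanishes[of r] from_outside_map_in[of q J r v] by simp
  qed (use unit add scale coherent_in[OF e] in auto)
  then show thesis by (rule that) simp
qed

end

locale pfd_module = persistence_module s le Q V f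
  for s :: "'k::field \<Rightarrow> 'v::ab_group_add \<Rightarrow> 'v" and le :: "'a \<Rightarrow> 'a \<Rightarrow> bool" (infix \<open>\<sqsubseteq>\<close> 50) and Q V f +
  assumes fin_dim: "p \<in> Q \<Longrightarrow> \<exists>B. finite B \<and> V p \<subseteq> span B"
begin

lemma pfd_module_submodule:
  assumes "submodule S"
  shows "pfd_module s (\<sqsubseteq>) Q S f"
proof -
  interpret S: persistence_module s "(\<sqsubseteq>)" Q S f
    by (rule persistence_module_submodule[OF assms])
  show ?thesis
  proof unfold_locales
    fix p assume p: "p \<in> Q"
    then have "S p \<subseteq> V p" using submodule_in[OF assms] by blast
    then show "\<exists>B. finite B \<and> S p \<subseteq> span B" using fin_dim[OF p] by (meson order_trans)
  qed
qed

lemma exists_in_least_nonzero: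
  fixes D :: "'i \<Rightarrow> 'v set"
  assumes "p \<in> Q" "\<And>t. subspace (D t)" "\<And>t. D t \<subseteq> V p" "\<And>t u. D t \<subseteq> D u \<or> D u \<subseteq> D t" "D u \<noteq> {0}"
  obtains m where "m \<noteq> 0" "m \<in> D u" "\<And>t. m \<in> D t \<or> D t = {0}"
proof -
  obtain B where B: "finite B" "V p \<subseteq> span B" using fin_dim[OF assms(1)] by blast
  show thesis
  proof (rule exists_in_least_nonzero_subspace[OF B(1), of D u])
    show "subspace (D t) \<and> D t \<subseteq> span B" for t using assms(2,3)[of t] B(2) by blast
  qed (fact assms(4,5) that)+
qed

lemma coherent_extension:
  assumes S: "submodule S" and P: "P \<subseteq> Q" "p \<in> P"
    and finite: "\<And>F. finite F \<Longrightarrow> F \<subseteq> P \<Longrightarrow> p \<in> F \<Longrightarrow> \<exists>e. coherent S F e \<and> e p = m"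
  obtains e where "coherent S P e" "e p = m"
proof -
  define E where "E F = {e. coherent S F e} \<inter> {e. p \<in> F \<longrightarrow> e p = m}" for F
  obtain e where e: "\<And>F. finite F \<Longrightarrow> F \<subseteq> P \<Longrightarrow> e \<in> E F"
  proof (rule linear_compactness[of P E])
    fix F assume F: "finite F" "F \<subseteq> P"
    obtain e where "coherent S (insert p F) e" "e p = m" using finite[of "insert p F"] F P(2) by auto
    then show "E F \<noteq> {}" by (auto simp: E_def coherent_def)
    have "affine_set (pointwise_scale s) {e. p \<in> F \<longrightarrow> e p = m}" by (simp add: affine_set_pointwise_iff)
    then show "affine_set (pointwise_scale s) (E F)"
      unfolding E_def using affine_set_coherent[OF S] F(2) P(1) by (intro affine_set_Int) auto
  next
    fix q assume q: "q \<in> P"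
    then obtain B where "finite B" "V q \<subseteq> span B" using fin_dim P(1) by blast
    moreover have "(\<lambda>e. e q) ` E {q} \<subseteq> V q"
      using q P(1) submodule_in[OF S] by (auto simp: E_def coherent_def)
    ultimately show "\<exists>B. finite B \<and> (\<lambda>e. e q) ` E {q} \<subseteq> span B" by blast
  next
    show "E G \<subseteq> E F" if "F \<subseteq> G" for F G
      using that coherent_subset by (auto simp: E_def)
  next
    show "d \<in> E F" if "c \<in> E F" "\<And>q. q \<in> F \<Longrightarrow> d q = c q" for F c d
      using that by (simp add: E_def coherent_def)
  qed (rule that)
  have "coherent S P e"
    unfolding coherent_def
  proof (intro conjI ballI impI)
    show "e q \<in> S q" if "q \<in> P" for q using e[of "{q}"] that by (simp add: E_def coherent_def)
    show "f q r (e q) = e r" if "q \<in> P" "r \<in> P" "q \<sqsubseteq> r" for q r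
      using e[of "{q, r}"] that by (simp add: E_def coherent_def)
  qed
  moreover have "e p = m" using e[of "{p}"] P(2) by (simp add: E_def)
  ultimately show thesis by (rule that)
qed

end

section \<open>Orthogonal families of summands\<close>

locale orthogonal_summands = pfd_module s le Q V f
  for s :: "'k::field \<Rightarrow> 'v::ab_group_add \<Rightarrow> 'v" and le :: "'a \<Rightarrow> 'a \<Rightarrow> bool" (infix \<open>\<sqsubseteq>\<close> 50) and Q V f +
  fixes \<F> :: "('a, 'v, 'k) summand set"
  assumes summand: "t \<in> \<F> \<Longrightarrow> is_summand t"
    and orthogonal: "t \<in> \<F> \<Longrightarrow> u \<in> \<F> \<Longrightarrow> t \<noteq> u \<Longrightarrow> p \<in> Q \<Longrightarrow> coordinate t p (generator u p) = 0"
begin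

definition summands_at :: "'a \<Rightarrow> ('a, 'v, 'k) summand set" where
  "summands_at p = {t \<in> \<F>. p \<in> shape t}"

definition combination :: "'a \<Rightarrow> (('a, 'v, 'k) summand \<Rightarrow> 'k) \<Rightarrow> 'v" where
  "combination p c = (\<Sum>t\<in>summands_at p. s (c t) (generator t p))"

definition common_kernel :: "'a \<Rightarrow> 'v set" where
  "common_kernel p = {v \<in> V p. \<forall>t\<in>\<F>. coordinate t p v = 0}"

definition projection :: "'a \<Rightarrow> 'v \<Rightarrow> 'v" where
  "projection p v = v - combination p (\<lambda>t. coordinate t p v)"

lemma summands_at_in: "t \<in> summands_at p \<Longrightarrow> t \<in> \<F>"
  by (simp add: summands_at_def)

lemma coordinate_generator_at:
  assumes "p \<in> Q" "t \<in> \<F>" "u \<in> summands_at p"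
  shows "coordinate t p (generator u p) = (if u = t then 1 else 0)"
  using assms orthogonal[of t u p] coordinate_generator[OF summand] by (auto simp: summands_at_def)

lemma independent_generators:
  assumes p: "p \<in> Q"
  shows "independent ((\<lambda>t. generator t p) ` summands_at p)" (is "independent ?G")
  unfolding dependent_def
proof
  assume "\<exists>g\<in>?G. g \<in> span (?G - {g})"
  then obtain t where t: "t \<in> summands_at p" "generator t p \<in> span (?G - {generator t p})" by blast
  then have "is_summand t" by (intro summand summands_at_in)
  let ?K = "{v \<in> V p. coordinate t p v = 0}"
  have "subspace ?K"
    by (rule subspaceI)
      (use p \<open>is_summand t\<close> in \<open>auto simp: coordinate_zero coordinate_add coordinate_scale add_in scale_in\<close>)
  moreover have "?G - {generator t p} \<subseteq> ?K"
    using p t(1) summand generator_in[OF _ p] by (auto simp: summands_at_def coordinate_generator_at)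
  ultimately have "generator t p \<in> ?K" using t(2) span_minimal by blast
  then show False using p t(1) summands_at_in by (simp add: coordinate_generator_at)
qed

lemma finite_summands_at:
  assumes p: "p \<in> Q"
  shows "finite (summands_at p)"
proof -
  have "(\<lambda>t. generator t p) ` summands_at p \<subseteq> V p"
    using generator_in[OF summand p] summands_at_in by blast
  moreover obtain B where "finite B" "V p \<subseteq> span B" using fin_dim[OF p] by blast
  ultimately have "finite ((\<lambda>t. generator t p) ` summands_at p)"
    using independent_span_bound[OF _ independent_generators[OF p]] by blast
  moreover have "inj_on (\<lambda>t. generator t p) (summands_at p)"
  proof (rule inj_onI, rule ccontr)
    fix t u assume tu: "t \<in> summands_at p" "u \<in> summands_at p" "generator t p = generator u p" "t \<noteq> u"
    then show False
      using coordinate_generator_at[OF p summands_at_in[OF tu(1)] tu(1)]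
        coordinate_generator_at[OF p summands_at_in[OF tu(1)] tu(2)] by simp
  qed
  ultimately show ?thesis by (rule finite_imageD)
qed

lemma combination_in: "p \<in> Q \<Longrightarrow> combination p c \<in> V p"
  unfolding combination_def
  by (intro subspace_sum subspace_V scale_in generator_in summand summands_at_in)

lemma coordinate_combination:
  assumes "t \<in> \<F>" "p \<in> Q"
  shows "coordinate t p (combination p c) = (if p \<in> shape t then c t else 0)"
proof -
  have V: "generator u p \<in> V p" if "u \<in> summands_at p" for u
    using that assms(2) by (intro generator_in summand summands_at_in)
  have "coordinate t p (combination p c) = (\<Sum>u\<in>summands_at p. coordinate t p (s (c u) (generator u p)))"
    unfolding combination_def
    by (rule coordinate_sum[OF summand[OF assms(1)] assms(2)]) (use V assms(2) scale_in in auto)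
  also have "\<dots> = (\<Sum>u\<in>summands_at p. if u = t then c t else 0)"
    by (rule sum.cong)
      (use V assms coordinate_scale[OF summand] in \<open>auto simp: coordinate_generator_at\<close>)
  also have "\<dots> = (if p \<in> shape t then c t else 0)"
    using finite_summands_at[OF assms(2)] assms(1) by (simp add: summands_at_def)
  finally show ?thesis .
qed

lemma map_combination:
  assumes "p \<in> Q" "p \<sqsubseteq> q" "v \<in> V p"
  shows "f p q (combination p (\<lambda>t. coordinate t p v)) = combination q (\<lambda>t. coordinate t q (f p q v))"
proof -
  have q: "q \<in> Q" using upward assms by blast
  let ?A = "summands_at p" and ?B = "summands_at q"
  have V: "generator t p \<in> V p" if "t \<in> ?A" for t
    using that assms(1) by (intro generator_in summand summands_at_in)
  have "f p q (combination p (\<lambda>t. coordinate t p v)) =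
      (\<Sum>t\<in>?A. f p q (s (coordinate t p v) (generator t p)))"
    unfolding combination_def by (rule map_sum[OF assms(1,2)]) (use V assms scale_in in auto)
  also have "\<dots> = (\<Sum>t\<in>?A. s (coordinate t p v) (generator t q))"
    by (rule sum.cong) (use V assms summand in \<open>auto simp: map_scale map_generator summands_at_def\<close>)
  also have "\<dots> = (\<Sum>t\<in>?A \<inter> ?B. s (coordinate t p v) (generator t q))"
    by (rule sum.mono_neutral_right)
      (use finite_summands_at[OF assms(1)] generator_out[OF summand q] in \<open>auto simp: summands_at_def\<close>)
  also have "\<dots> = (\<Sum>t\<in>?B. s (coordinate t p v) (generator t q))"
    by (rule sum.mono_neutral_left)
      (use finite_summands_at[OF q] coordinate_out[OF summand assms(1) _ assms(3)]
        in \<open>auto simp: summands_at_def\<close>)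
  also have "\<dots> = combination q (\<lambda>t. coordinate t q (f p q v))"
    unfolding combination_def
    by (rule sum.cong) (use assms coordinate_map[OF summand] in \<open>auto simp: summands_at_def\<close>)
  finally show ?thesis .
qed

lemma common_kernel_in: "v \<in> common_kernel p \<Longrightarrow> v \<in> V p"
  by (simp add: common_kernel_def)

lemma submodule_common_kernel: "submodule common_kernel"
  unfolding submodule_def
proof (intro ballI conjI allI impI)
  fix p assume p: "p \<in> Q"
  show "subspace (common_kernel p)"
    by (rule subspaceI)
      (use p summand in \<open>auto simp: common_kernel_def coordinate_zero coordinate_add coordinate_scale
        add_in scale_in\<close>)
  show "common_kernel p \<subseteq> V p" using common_kernel_in by blast
  fix q assume q: "p \<sqsubseteq> q"
  have "coordinate t q (f p q v) = 0" if t: "t \<in> \<F>" and v: "v \<in> common_kernel p" for t v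
  proof (cases "q \<in> shape t")
    case True
    then show ?thesis
      using coordinate_map[OF summand[OF t] p q True common_kernel_in[OF v]] t v
      by (simp add: common_kernel_def)
  next
    case False
    then show ?thesis
      using coordinate_out[OF summand[OF t] upward[OF p q] False] map_in[OF p q common_kernel_in[OF v]]
      by simp
  qed
  then show "f p q ` common_kernel p \<subseteq> common_kernel q"
    using map_in[OF p q] by (auto simp: common_kernel_def)
qed

lemma projection_in_common_kernel:
  assumes "p \<in> Q" "v \<in> V p"
  shows "projection p v \<in> common_kernel p"
proof -
  have "coordinate t p (projection p v) = 0" if t: "t \<in> \<F>" for t
    using coordinate_diff[OF summand[OF t] assms combination_in[OF assms(1)]]
      coordinate_combination[OF t assms(1)] coordinate_out[OF summand[OF t] assms(1) _ assms(2)]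
    unfolding projection_def by simp
  then show ?thesis using diff_in combination_in assms by (simp add: common_kernel_def projection_def)
qed

lemma projection_common_kernel [simp]: "v \<in> common_kernel p \<Longrightarrow> projection p v = v"
  by (simp add: projection_def combination_def common_kernel_def summands_at_def)

lemma projection_generator:
  assumes "t \<in> \<F>" "p \<in> Q"
  shows "projection p (generator t p) = 0"
proof -
  have "combination p (\<lambda>u. coordinate u p (generator t p)) = generator t p"
  proof (cases "p \<in> shape t")
    case True
    then have t: "t \<in> summands_at p" using assms(1) by (simp add: summands_at_def)
    have "combination p (\<lambda>u. coordinate u p (generator t p)) =
        (\<Sum>u\<in>summands_at p. if u = t then generator t p else 0)"
      unfolding combination_def
      by (rule sum.cong) (use assms(2) t summands_at_in in \<open>auto simp: coordinate_generator_at\<close>)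
    then show ?thesis using finite_summands_at[OF assms(2)] t by simp
  next
    case False
    then have "generator t p = 0" by (intro generator_out[OF summand] assms)
    then show ?thesis
      using assms(2) coordinate_zero[OF summand] by (simp add: combination_def summands_at_def)
  qed
  then show ?thesis by (simp add: projection_def)
qed

lemma projection_add:
  assumes "p \<in> Q" "v \<in> V p" "w \<in> V p"
  shows "projection p (v + w) = projection p v + projection p w"
proof -
  have "combination p (\<lambda>t. coordinate t p (v + w)) =
      combination p (\<lambda>t. coordinate t p v) + combination p (\<lambda>t. coordinate t p w)"
    unfolding combination_def sum.distrib[symmetric]
    by (rule sum.cong)
      (use assms coordinate_add[OF summand] summands_at_in in \<open>auto simp: scale_left_distrib\<close>)
  then show ?thesis by (simp add: projection_def)
qed

lemma projection_scale:
  assumes "p \<in> Q" "v \<in> V p"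
  shows "projection p (s a v) = s a (projection p v)"
proof -
  have "combination p (\<lambda>t. coordinate t p (s a v)) = s a (combination p (\<lambda>t. coordinate t p v))"
    unfolding combination_def scale_sum_right
    by (rule sum.cong) (use assms coordinate_scale[OF summand] summands_at_in in auto)
  then show ?thesis by (simp add: projection_def scale_right_diff_distrib)
qed

lemma map_projection:
  "p \<in> Q \<Longrightarrow> p \<sqsubseteq> q \<Longrightarrow> v \<in> V p \<Longrightarrow> f p q (projection p v) = projection q (f p q v)"
  by (simp add: projection_def map_diff combination_in map_combination)

sublocale common_kernel: pfd_module s "(\<sqsubseteq>)" Q common_kernel f
  by (rule pfd_module_submodule[OF submodule_common_kernel])

lemma summand_of_common_kernel:
  assumes t: "common_kernel.is_summand t"
  shows "is_summand (Summand (shape t) (generator t) (\<lambda>p v. coordinate t p (projection p v)))"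
    (is "is_summand ?t")
  unfolding is_summand_def
proof (intro conjI ballI allI impI)
  fix p assume p: "p \<in> Q"
  have g: "generator t p \<in> common_kernel p" by (rule common_kernel.generator_in[OF t p])
  then show "generator ?t p \<in> V p" by (simp add: common_kernel_in)
  show "coordinate ?t p (v + w) = coordinate ?t p v + coordinate ?t p w" if "v \<in> V p" "w \<in> V p" for v w
    using p that
    by (simp add: projection_add projection_in_common_kernel common_kernel.coordinate_add[OF t])
  show "coordinate ?t p (s a v) = a * coordinate ?t p v" if "v \<in> V p" for a v
    using p that
    by (simp add: projection_scale projection_in_common_kernel common_kernel.coordinate_scale[OF t])
  fix q assume q: "p \<sqsubseteq> q"
  show "f p q (generator ?t p) = generator ?t q" if "p \<in> shape ?t"
    using common_kernel.map_generator[OF t p q] that by simp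
  show "coordinate ?t q (f p q v) = coordinate ?t p v" if "q \<in> shape ?t" "v \<in> V p" for v
    using common_kernel.coordinate_map[OF t p q] that p q
    by (simp add: map_projection[symmetric] projection_in_common_kernel)
next
  fix p assume p: "p \<in> Q - shape ?t"
  show "generator ?t p = 0" using p common_kernel.generator_out[OF t] by simp
  show "coordinate ?t p v = 0" if "v \<in> V p" for v
    using p that by (simp add: projection_in_common_kernel common_kernel.coordinate_out[OF t])
next
  fix p assume "p \<in> Q \<inter> shape ?t"
  then show "coordinate ?t p (generator ?t p) = 1"
    by (simp add: common_kernel.generator_in[OF t] common_kernel.coordinate_generator[OF t])
qed

lemma orthogonal_summands_insert:
  assumes t: "common_kernel.is_summand t" and "shape t \<inter> Q \<noteq> {}"
  obtains u where "shape u = shape t" "u \<notin> \<F>" "orthogonal_summands s (\<sqsubseteq>) Q V f (insert u \<F>)"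
proof -
  let ?u = "Summand (shape t) (generator t) (\<lambda>p v. coordinate t p (projection p v))"
  have old_new: "coordinate u p (generator ?u p) = 0" if "u \<in> \<F>" "p \<in> Q" for u p
    using common_kernel.generator_in[OF t that(2)] that(1) by (simp add: common_kernel_def)
  have new_old: "coordinate ?u p (generator u p) = 0" if "u \<in> \<F>" "p \<in> Q" for u p
    using that by (simp add: projection_generator common_kernel.coordinate_zero[OF t])
  have summand_u: "is_summand ?u" by (rule summand_of_common_kernel[OF t])
  have "?u \<notin> \<F>"
  proof
    assume u: "?u \<in> \<F>"
    obtain p where p: "p \<in> shape ?u" "p \<in> Q" using assms(2) by auto
    have "coordinate ?u p (generator ?u p) = 1" by (rule coordinate_generator[OF summand_u p(2,1)])
    then show False using old_new[OF u p(2)] by simp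
  qed
  moreover have "orthogonal_summands s (\<sqsubseteq>) Q V f (insert ?u \<F>)"
  proof unfold_locales
    show "is_summand v" if "v \<in> insert ?u \<F>" for v using that summand summand_u by blast
    show "coordinate v p (generator w p) = 0"
      if "v \<in> insert ?u \<F>" "w \<in> insert ?u \<F>" "v \<noteq> w" "p \<in> Q" for v w p
      using that orthogonal old_new new_old by blast
  qed
  ultimately show thesis by (intro that[of ?u]) simp_all
qed

lemma index_by_points:
  assumes "\<And>t. t \<in> \<F> \<Longrightarrow> shape t \<inter> Q \<noteq> {}"
  obtains \<iota> :: "('a, 'v, 'k) summand \<Rightarrow> 'a \<times> nat" where "inj_on \<iota> \<F>"
proof -
  have "\<forall>t\<in>\<F>. \<exists>p. p \<in> shape t \<inter> Q" using assms by blast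
  then obtain pt where pt: "\<And>t. t \<in> \<F> \<Longrightarrow> pt t \<in> shape t \<inter> Q" by metis
  let ?\<iota> = "\<lambda>t. (pt t, to_nat_on (summands_at (pt t)) t)"
  have "inj_on ?\<iota> \<F>"
  proof (rule inj_onI)
    fix t u assume tu: "t \<in> \<F>" "u \<in> \<F>" "?\<iota> t = ?\<iota> u"
    then have "t \<in> summands_at (pt t)" "u \<in> summands_at (pt t)"
      using pt[OF tu(1)] pt[OF tu(2)] by (auto simp: summands_at_def)
    moreover have "countable (summands_at (pt t))"
      using finite_summands_at pt[OF tu(1)] by (simp add: countable_finite)
    ultimately show "t = u" using tu(3) by (metis Pair_inject to_nat_on_inj)
  qed
  then show thesis by (rule that)
qed

end

context pfd_module
begin

lemma maximal_orthogonal_summands: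
  obtains \<F> where "orthogonal_summands s (\<sqsubseteq>) Q V f \<F>" "shape ` \<F> \<subseteq> \<J>"
    "\<And>\<G>. orthogonal_summands s (\<sqsubseteq>) Q V f \<G> \<Longrightarrow> shape ` \<G> \<subseteq> \<J> \<Longrightarrow> \<F> \<subseteq> \<G> \<Longrightarrow> \<G> = \<F>"
proof -
  let ?Z = "{\<F>. orthogonal_summands s (\<sqsubseteq>) Q V f \<F> \<and> shape ` \<F> \<subseteq> \<J>}"
  have "orthogonal_summands s (\<sqsubseteq>) Q V f {}" by unfold_locales auto
  then have "?Z \<noteq> {}" by blast
  then have "\<exists>\<F>\<in>?Z. \<forall>\<G>\<in>?Z. \<F> \<subseteq> \<G> \<longrightarrow> \<G> = \<F>"
  proof (rule subset_Zorn_nonempty)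
    fix \<C> assume "\<C> \<noteq> {}" and chain: "subset.chain ?Z \<C>"
    then have \<C>: "orthogonal_summands s (\<sqsubseteq>) Q V f \<G>" "shape ` \<G> \<subseteq> \<J>" if "\<G> \<in> \<C>" for \<G>
      using that by (auto simp: subset.chain_def)
    have "orthogonal_summands s (\<sqsubseteq>) Q V f (\<Union>\<C>)"
    proof unfold_locales
      fix t assume "t \<in> \<Union>\<C>"
      then obtain \<G> where "\<G> \<in> \<C>" "t \<in> \<G>" by blast
      then show "is_summand t" by (intro orthogonal_summands.summand[OF \<C>(1)])
    next
      fix t u p assume tu: "t \<in> \<Union>\<C>" "u \<in> \<Union>\<C>" "t \<noteq> u" "p \<in> Q"
      obtain \<G> where "\<G> \<in> \<C>" "{t, u} \<subseteq> \<G>"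
        by (rule finite_subset_Union_chain[OF _ _ \<open>\<C> \<noteq> {}\<close> chain, of "{t, u}"]) (use tu in auto)
      then show "coordinate t p (generator u p) = 0"
        using tu by (intro orthogonal_summands.orthogonal[OF \<C>(1)]) auto
    qed
    moreover have "shape ` \<Union>\<C> \<subseteq> \<J>" using \<C>(2) by fast
    ultimately show "\<Union>\<C> \<in> ?Z" by simp
  qed
  then obtain \<F> where "\<F> \<in> ?Z" and maximal: "\<forall>\<G>\<in>?Z. \<F> \<subseteq> \<G> \<longrightarrow> \<G> = \<F>" by (elim bexE)
  then show thesis by (intro that[of \<F>]) simp_all
qed

theorem complete_orthogonal_summands:
  assumes \<J>: "\<And>J. J \<in> \<J> \<Longrightarrow> J \<inter> Q \<noteq> {}"
    and split: "\<And>\<F> p v. orthogonal_summands s (\<sqsubseteq>) Q V f \<F> \<Longrightarrow> p \<in> Q \<Longrightarrow>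
      v \<in> orthogonal_summands.common_kernel V \<F> p \<Longrightarrow> v \<noteq> 0 \<Longrightarrow>
      \<exists>t. persistence_module.is_summand s (\<sqsubseteq>) Q (orthogonal_summands.common_kernel V \<F>) f t \<and> shape t \<in> \<J>"
  obtains \<F> where "orthogonal_summands s (\<sqsubseteq>) Q V f \<F>" "shape ` \<F> \<subseteq> \<J>"
    "\<And>p v. p \<in> Q \<Longrightarrow> v \<in> orthogonal_summands.common_kernel V \<F> p \<Longrightarrow> v = 0"
proof -
  obtain \<F> where \<F>: "orthogonal_summands s (\<sqsubseteq>) Q V f \<F>" "shape ` \<F> \<subseteq> \<J>" and maximal:
    "\<And>\<G>. orthogonal_summands s (\<sqsubseteq>) Q V f \<G> \<Longrightarrow> shape ` \<G> \<subseteq> \<J> \<Longrightarrow> \<F> \<subseteq> \<G> \<Longrightarrow> \<G> = \<F>"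
    by (rule maximal_orthogonal_summands[of \<J>]) (rule that)
  interpret orthogonal_summands s "(\<sqsubseteq>)" Q V f \<F> by (rule \<F>(1))
  have "v = 0" if v: "p \<in> Q" "v \<in> common_kernel p" for p v
  proof (rule ccontr)
    assume "v \<noteq> 0"
    then obtain t where t: "common_kernel.is_summand t" "shape t \<in> \<J>"
      using split[OF \<F>(1) v] by blast
    obtain u where u: "shape u = shape t" "u \<notin> \<F>" "orthogonal_summands s (\<sqsubseteq>) Q V f (insert u \<F>)"
      by (rule orthogonal_summands_insert[OF t(1) \<J>[OF t(2)]])
    then have "insert u \<F> = \<F>" using maximal[OF u(3)] \<F>(2) t(2) by auto
    then show False using u(2) by blast
  qed
  then show thesis using that \<F> by blast
qed

end

locale complete_orthogonal_summands = orthogonal_summands s le Q V f \<F>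
  for s :: "'k::field \<Rightarrow> 'v::ab_group_add \<Rightarrow> 'v" and le :: "'a \<Rightarrow> 'a \<Rightarrow> bool" (infix \<open>\<sqsubseteq>\<close> 50) and Q V f \<F> +
  assumes complete: "p \<in> Q \<Longrightarrow> v \<in> common_kernel p \<Longrightarrow> v = 0"
begin

lemma eq_if_coordinates_eq:
  assumes "p \<in> Q" "v \<in> V p" "w \<in> V p" "\<And>t. t \<in> \<F> \<Longrightarrow> coordinate t p v = coordinate t p w"
  shows "v = w"
proof -
  have "v - w \<in> common_kernel p"
    using assms by (simp add: common_kernel_def diff_in coordinate_diff[OF summand])
  then show ?thesis using complete[OF assms(1)] by fastforce
qed

context
  fixes I :: "'i set" and \<tau> :: "'i \<Rightarrow> ('a, 'v, 'k) summand"
  assumes \<tau>: "bij_betw \<tau> I \<F>"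
begin

definition coordinates :: "'a \<Rightarrow> 'v \<Rightarrow> 'i \<Rightarrow> 'k" where
  "coordinates p v i = (if i \<in> I then coordinate (\<tau> i) p v else 0)"

lemma \<tau>_in: "i \<in> I \<Longrightarrow> \<tau> i \<in> \<F>"
  using \<tau> by (rule bij_betw_apply)

lemma finite_indices_at:
  assumes "p \<in> Q"
  shows "finite {i \<in> I. p \<in> shape (\<tau> i)}"
proof (rule finite_imageD)
  show "inj_on \<tau> {i \<in> I. p \<in> shape (\<tau> i)}"
    using bij_betw_imp_inj_on[OF \<tau>] by (rule inj_on_subset) blast
  show "finite (\<tau> ` {i \<in> I. p \<in> shape (\<tau> i)})"
    using finite_summands_at[OF assms] by (rule rev_finite_subset) (auto simp: summands_at_def \<tau>_in)
qed

lemma bij_betw_coordinates: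
  assumes p: "p \<in> Q"
  shows "bij_betw (coordinates p) (V p) {c. \<forall>i. c i \<noteq> 0 \<longrightarrow> i \<in> I \<and> p \<in> shape (\<tau> i)}"
  unfolding bij_betw_def
proof (intro conjI inj_onI subset_antisym subsetI)
  fix v w assume v: "v \<in> V p" "w \<in> V p" "coordinates p v = coordinates p w"
  have "coordinate t p v = coordinate t p w" if "t \<in> \<F>" for t
  proof -
    obtain i where "i \<in> I" "t = \<tau> i" using \<open>t \<in> \<F>\<close> bij_betw_imp_surj_on[OF \<tau>] by blast
    then show ?thesis using fun_cong[OF v(3), of i] by (simp add: coordinates_def)
  qed
  then show "v = w" using eq_if_coordinates_eq[OF p v(1,2)] by blast
next
  fix c assume "c \<in> coordinates p ` V p"
  then show "c \<in> {c. \<forall>i. c i \<noteq> 0 \<longrightarrow> i \<in> I \<and> p \<in> shape (\<tau> i)}"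
    using p coordinate_out[OF summand[OF \<tau>_in]] by (force simp: coordinates_def split: if_splits)
next
  fix c :: "'i \<Rightarrow> 'k" assume c: "c \<in> {c. \<forall>i. c i \<noteq> 0 \<longrightarrow> i \<in> I \<and> p \<in> shape (\<tau> i)}"
  let ?v = "combination p (\<lambda>t. c (inv_into I \<tau> t))"
  have "coordinates p ?v i = c i" for i
    using c p bij_betw_inv_into_left[OF \<tau>, of i]
    by (auto simp: coordinates_def coordinate_combination \<tau>_in)
  then show "c \<in> coordinates p ` V p"
    using combination_in[OF p] by (metis ext image_eqI)
qed

lemma coordinates_add:
  "p \<in> Q \<Longrightarrow> v \<in> V p \<Longrightarrow> w \<in> V p \<Longrightarrow> coordinates p (v + w) i = coordinates p v i + coordinates p w i"
  by (simp add: coordinates_def coordinate_add[OF summand] \<tau>_in)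

lemma coordinates_scale: "p \<in> Q \<Longrightarrow> v \<in> V p \<Longrightarrow> coordinates p (s a v) i = a * coordinates p v i"
  by (simp add: coordinates_def coordinate_scale[OF summand] \<tau>_in)

lemma coordinates_map:
  assumes "p \<in> Q" "p \<sqsubseteq> q" "v \<in> V p"
  shows "coordinates q (f p q v) i = (if q \<in> shape (\<tau> i) then coordinates p v i else 0)"
  using assms upward[of p q] coordinate_map[OF summand[OF \<tau>_in]]
    coordinate_out[OF summand[OF \<tau>_in] _ _ map_in]
  by (simp add: coordinates_def)

end

end

section \<open>Middle exact modules in the plane\<close>

lemma le2_Pair [simp]: "le2 (a, b) (c, d) \<longleftrightarrow> a \<le> c \<and> b \<le> d"
  by (simp add: le2_def)

lemma le2_refl [simp]: "le2 p p"
  by (simp add: le2_def)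

lemma le2_trans: "le2 p q \<Longrightarrow> le2 q r \<Longrightarrow> le2 p r"
  by (auto simp: le2_def)

lemma le2_swap [simp]: "le2 (prod.swap p) (prod.swap q) \<longleftrightarrow> le2 p q"
  by (auto simp: le2_def)

definition join :: "real \<times> real \<Rightarrow> real \<times> real \<Rightarrow> real \<times> real" where
  "join p q = (max (fst p) (fst q), max (snd p) (snd q))"

lemma le2_join [simp]: "le2 p (join p q)" "le2 q (join p q)"
  by (auto simp: join_def le2_def)

lemma join_le2_iff: "le2 (join p q) r \<longleftrightarrow> le2 p r \<and> le2 q r"
  by (auto simp: join_def le2_def)

lemma join_commute: "join p q = join q p"
  by (simp add: join_def max.commute)

lemma join_in_Times: "p \<in> A \<times> B \<Longrightarrow> q \<in> A \<times> B \<Longrightarrow> join p q \<in> A \<times> B"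
  by (auto simp: join_def max_def)

lemma down_closedD: "down_closed J \<Longrightarrow> x \<in> J \<Longrightarrow> y \<le> x \<Longrightarrow> y \<in> J"
  by (auto simp: down_closed_def)

lemma up_closedD: "up_closed J \<Longrightarrow> x \<in> J \<Longrightarrow> x \<le> y \<Longrightarrow> y \<in> J"
  by (auto simp: up_closed_def)

lemma up_closed_imp_ord_convex: "up_closed J \<Longrightarrow> ord_convex J"
  unfolding up_closed_def ord_convex_def by blast

lemma is_block_TimesI:
  assumes "I \<noteq> {}" "I' \<noteq> {}"
    and "down_closed I \<and> down_closed I' \<or> up_closed I \<and> up_closed I' \<or>
      ord_convex I \<and> I' = UNIV \<or> I = UNIV \<and> ord_convex I'"
  shows "is_block (I \<times> I')"
  using assms unfolding is_block_def by (metis Times_empty)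

lemma is_block_swap:
  assumes "is_block J"
  shows "is_block (prod.swap -` J)"
proof -
  have "prod.swap -` (X \<times> Y) = Y \<times> X" for X Y :: "real set" by auto
  then show ?thesis
    using assms unfolding is_block_def[of J]
    by (elim conjE disjE exE) (simp_all add: is_block_TimesI)
qed

abbreviation swap_maps ::
  "(real \<times> real \<Rightarrow> real \<times> real \<Rightarrow> 'v \<Rightarrow> 'v) \<Rightarrow> real \<times> real \<Rightarrow> real \<times> real \<Rightarrow> 'v \<Rightarrow> 'v" where
  "swap_maps f \<equiv> \<lambda>p q. f (prod.swap p) (prod.swap q)"

text \<open>An open half-plane contains no antidiagonal below all of its points, whence the restriction to
  finite sets \<open>F\<close>.\<close>

locale middle_exact_module = pfd_module s le2 Q V f
  for s :: "'k::field \<Rightarrow> 'v::ab_group_add \<Rightarrow> 'v" and Q :: "(real \<times> real) set" and V f +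
  assumes antidiagonal: "finite F \<Longrightarrow> F \<subseteq> Q \<Longrightarrow>
      \<exists>c. (\<forall>x. (x, c - x) \<in> Q) \<and> (\<forall>q\<in>F. c \<le> fst q + snd q)"
    and exact: "(x, y) \<in> Q \<Longrightarrow> x \<le> x' \<Longrightarrow> y \<le> y' \<Longrightarrow> u \<in> V (x, y') \<Longrightarrow> w \<in> V (x', y) \<Longrightarrow>
      f (x, y') (x', y') u = f (x', y) (x', y') w \<Longrightarrow>
      \<exists>z\<in>V (x, y). f (x, y) (x, y') z = u \<and> f (x, y) (x', y) z = w"
begin

lemma swap_module: "middle_exact_module s (prod.swap -` Q) (V \<circ> prod.swap) (swap_maps f)"
proof unfold_locales
  show "q \<in> prod.swap -` Q" if "p \<in> prod.swap -` Q" "le2 p q" for p q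
    using that upward[of "prod.swap p" "prod.swap q"] by simp
  show "le2 p r" if "le2 p q" "le2 q r" for p q r using that by (rule le2_trans)
  show "\<exists>B. finite B \<and> (V \<circ> prod.swap) p \<subseteq> span B" if "p \<in> prod.swap -` Q" for p
    using fin_dim that by simp
next
  fix F assume F: "finite F" "F \<subseteq> prod.swap -` Q"
  then have "finite (prod.swap ` F)" "prod.swap ` F \<subseteq> Q" by auto
  then obtain c where c: "\<And>x. (x, c - x) \<in> Q" "\<And>q. q \<in> prod.swap ` F \<Longrightarrow> c \<le> fst q + snd q"
    using antidiagonal by meson
  have "(x, c - x) \<in> prod.swap -` Q" for x using c(1)[of "c - x"] by simp
  moreover have "c \<le> fst q + snd q" if "q \<in> F" for q
    using c(2)[of "prod.swap q"] that by (simp add: add.commute)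
  ultimately show "\<exists>c. (\<forall>x. (x, c - x) \<in> prod.swap -` Q) \<and> (\<forall>q\<in>F. c \<le> fst q + snd q)" by blast
next
  fix x y x' y' u w
  assume "(x, y) \<in> prod.swap -` Q" "x \<le> x'" "y \<le> y'"
    "u \<in> (V \<circ> prod.swap) (x, y')" "w \<in> (V \<circ> prod.swap) (x', y)"
    "swap_maps f (x, y') (x', y') u = swap_maps f (x', y) (x', y') w"
  then show "\<exists>z\<in>(V \<circ> prod.swap) (x, y). swap_maps f (x, y) (x, y') z = u \<and> swap_maps f (x, y) (x', y) z = w"
    using exact[of y x y' x' w u] by auto
qed (auto simp: subspace_V map_in map_add map_scale map_comp simp del: swap_simp)

definition block_summand :: "(real \<times> real, 'v, 'k) summand \<Rightarrow> bool" where
  "block_summand t \<longleftrightarrow> is_summand t \<and> is_block (shape t) \<and> shape t \<inter> Q \<noteq> {}"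

lemma block_summand_if_not_from_outside:
  assumes "is_block (A \<times> B)" and p: "p \<in> A \<times> B \<inter> Q" and e: "coherent V (A \<times> B \<inter> Q) e"
    and dies: "\<And>q r. q \<in> A \<times> B \<inter> Q \<Longrightarrow> le2 q r \<Longrightarrow> r \<notin> A \<times> B \<Longrightarrow> f q r (e q) = 0"
    and lives: "\<And>r. r \<in> A \<times> B \<Longrightarrow> le2 p r \<Longrightarrow> f p r (e p) \<notin> from_outside (A \<times> B) r"
  shows "\<exists>t. block_summand t"
proof -
  have "\<exists>t\<in>A \<times> B \<inter> Q. le2 q t \<and> le2 r t" if "q \<in> A \<times> B \<inter> Q" "r \<in> A \<times> B \<inter> Q" for q r
    using that join_in_Times[of q A B r] upward[of q "join q r"] by (intro bexI[of _ "join q r"]) auto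
  then obtain t where t: "is_summand t" "shape t = A \<times> B"
    by (rule summand_if_not_from_outside[OF p _ e dies lives])
  then have "shape t \<inter> Q \<noteq> {}" using p by blast
  then show ?thesis using assms(1) t unfolding block_summand_def by metis
qed

definition hkernel :: "real \<times> real \<Rightarrow> real \<Rightarrow> 'v set" where
  "hkernel p a = kernel p (max (fst p) a, snd p)"

definition vkernel :: "real \<times> real \<Rightarrow> real \<Rightarrow> 'v set" where
  "vkernel p b = kernel p (fst p, max (snd p) b)"

lemma hkernel_in: "v \<in> hkernel p a \<Longrightarrow> v \<in> V p"
  by (simp add: hkernel_def kernel_def)

lemma subspace_hkernel: "p \<in> Q \<Longrightarrow> subspace (hkernel p a)"
  unfolding hkernel_def by (rule subspace_kernel) (auto simp: le2_def)

lemma hkernel_mono: "p \<in> Q \<Longrightarrow> a \<le> b \<Longrightarrow> hkernel p a \<subseteq> hkernel p b"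
  unfolding hkernel_def by (rule kernel_mono) (auto simp: le2_def)

lemma hkernel_chain: "p \<in> Q \<Longrightarrow> hkernel p a \<subseteq> hkernel p b \<or> hkernel p b \<subseteq> hkernel p a"
  using hkernel_mono[of p a b] hkernel_mono[of p b a] linear[of a b] by blast

lemma hkernel_eq_kernel: "x \<le> a \<Longrightarrow> hkernel (x, y) a = kernel (x, y) (a, y)"
  by (simp add: hkernel_def max_absorb2)

lemma hkernel_trivial: "p \<in> Q \<Longrightarrow> a \<le> fst p \<Longrightarrow> hkernel p a = {0}"
  by (auto simp: hkernel_def kernel_def max_absorb1)

end

context middle_exact_module
begin

interpretation swap: middle_exact_module s "prod.swap -` Q" "V \<circ> prod.swap" "swap_maps f"
  by (rule swap_module)

lemma swap_kernel: "swap.kernel p q = kernel (prod.swap p) (prod.swap q)"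
  by (simp add: swap.kernel_def kernel_def)

lemma swap_dying_outside: "swap.dying_outside (prod.swap -` J) q = dying_outside J (prod.swap q)"
proof -
  have "(\<forall>r. le2 q r \<longrightarrow> r \<notin> prod.swap -` J \<longrightarrow> swap_maps f q r v = 0) \<longleftrightarrow>
        (\<forall>r. le2 (prod.swap q) r \<longrightarrow> r \<notin> J \<longrightarrow> f (prod.swap q) r v = 0)" for v
    by (metis (no_types, lifting) le2_swap swap_swap vimage_eq)
  then show ?thesis by (simp add: swap.dying_outside_def dying_outside_def)
qed

lemma swap_hkernel: "swap.hkernel p b = vkernel (prod.swap p) b"
  by (simp add: swap.hkernel_def vkernel_def swap_kernel)

lemma subspace_vkernel: "p \<in> Q \<Longrightarrow> subspace (vkernel p b)"
  using swap.subspace_hkernel[of "prod.swap p" b] by (simp add: swap_hkernel)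

lemma vkernel_mono: "p \<in> Q \<Longrightarrow> a \<le> b \<Longrightarrow> vkernel p a \<subseteq> vkernel p b"
  using swap.hkernel_mono[of "prod.swap p" a b] by (simp add: swap_hkernel)

lemma vkernel_trivial: "p \<in> Q \<Longrightarrow> b \<le> snd p \<Longrightarrow> vkernel p b = {0}"
  using swap.hkernel_trivial[of "prod.swap p" b] by (simp add: swap_hkernel)

lemma block_summand_swap:
  assumes "swap.block_summand t"
  shows "block_summand
      (Summand (prod.swap -` shape t) (generator t \<circ> prod.swap) (coordinate t \<circ> prod.swap))"
    (is "block_summand ?t")
proof -
  have t: "swap.is_summand t" and block: "is_block (shape t)" "shape t \<inter> prod.swap -` Q \<noteq> {}"
    using assms by (auto simp: swap.block_summand_def)
  have "is_summand ?t"
    unfolding is_summand_def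
  proof (intro conjI ballI allI impI)
    fix p assume p: "p \<in> Q"
    then have p': "prod.swap p \<in> prod.swap -` Q" by simp
    show "generator ?t p \<in> V p" using swap.generator_in[OF t p'] by simp
    show "coordinate ?t p (v + w) = coordinate ?t p v + coordinate ?t p w" if "v \<in> V p" "w \<in> V p" for v w
      using swap.coordinate_add[OF t p'] that by simp
    show "coordinate ?t p (s a v) = a * coordinate ?t p v" if "v \<in> V p" for a v
      using swap.coordinate_scale[OF t p'] that by simp
    fix q assume q: "le2 p q"
    show "f p q (generator ?t p) = generator ?t q" if "p \<in> shape ?t"
      using swap.map_generator[OF t p', of "prod.swap q"] q that by simp
    show "coordinate ?t q (f p q v) = coordinate ?t p v" if "q \<in> shape ?t" "v \<in> V p" for v
      using swap.coordinate_map[OF t p', of "prod.swap q"] q that by simp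
  next
    fix p assume p: "p \<in> Q - shape ?t"
    then have p': "prod.swap p \<in> prod.swap -` Q" "prod.swap p \<notin> shape t" by simp_all
    show "generator ?t p = 0" using swap.generator_out[OF t p'] by simp
    show "coordinate ?t p v = 0" if "v \<in> V p" for v using swap.coordinate_out[OF t p'] that by simp
  next
    fix p assume "p \<in> Q \<inter> shape ?t"
    then show "coordinate ?t p (generator ?t p) = 1"
      using swap.coordinate_generator[OF t, of "prod.swap p"] by simp
  qed
  moreover obtain q where "q \<in> shape t" "prod.swap q \<in> Q" using block(2) by auto
  then have "prod.swap q \<in> shape ?t \<inter> Q" by simp
  then have "shape ?t \<inter> Q \<noteq> {}" by blast
  ultimately show ?thesis using is_block_swap[OF block(1)] by (simp add: block_summand_def)
qed

end

section \<open>Sections of surjective submodules\<close>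

lemma finite_chain_has_outer_neighbour:
  fixes X :: "'x::linorder set"
  assumes "finite X" "a \<in> X" "X \<noteq> {a}"
  obtains b n where "b \<in> X - {a}" "n \<in> X - {b}"
    "\<And>x. x \<in> X - {b} \<Longrightarrow> x \<le> n \<and> n \<le> b \<or> b \<le> n \<and> n \<le> x"
proof (cases "Max X = a")
  case False
  let ?b = "Max X" and ?n = "Max (X - {Max X})"
  have b: "?b \<in> X - {a}" using Max_in[of X] assms(1,2) False by blast
  moreover have n: "?n \<in> X - {?b}" using Max_in[of "X - {?b}"] assms(1,2) False by blast
  moreover have "x \<le> ?n \<and> ?n \<le> ?b" if "x \<in> X - {?b}" for x
    using that n assms(1) by (intro conjI Max_ge) auto
  ultimately show thesis using that by blast
next
  case True
  let ?b = "Min X" and ?n = "Min (X - {Min X})"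
  obtain x where "x \<in> X" "x \<noteq> a" using assms(2,3) by blast
  then have "?b < a"
    using Min_le[OF assms(1), of x] Max_ge[OF assms(1), of x] True by auto
  then have b: "?b \<in> X - {a}" using Min_in[of X] assms(1,2) by blast
  moreover have n: "?n \<in> X - {?b}" using Min_in[of "X - {?b}"] assms(1,2) \<open>?b < a\<close> by blast
  moreover have "?b \<le> ?n \<and> ?n \<le> x" if "x \<in> X - {?b}" for x
    using that n assms(1) by (intro conjI Min_le) auto
  ultimately show thesis using that by blast
qed

text \<open>The values are chosen one after the other, moving away from \<open>a\<close> in both directions.\<close>

lemma finite_chain_choice:
  fixes X :: "'x::linorder set" and C :: "'x \<Rightarrow> 'b \<Rightarrow> 'x \<Rightarrow> 'b \<Rightarrow> bool"
  assumes "finite X" "a \<in> X" "v \<in> A a"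
    and refl: "\<And>x u. C x u x u" and sym: "\<And>x u y w. C x u y w \<Longrightarrow> C y w x u"
    and step: "\<And>x y u. u \<in> A x \<Longrightarrow> \<exists>w\<in>A y. C x u y w"
    and trans: "\<And>x y z u v w. x \<le> y \<Longrightarrow> y \<le> z \<Longrightarrow> u \<in> A x \<Longrightarrow> v \<in> A y \<Longrightarrow> w \<in> A z \<Longrightarrow>
      C x u y v \<Longrightarrow> C y v z w \<Longrightarrow> C x u z w"
  shows "\<exists>g. g a = v \<and> (\<forall>x\<in>X. g x \<in> A x) \<and> (\<forall>x\<in>X. \<forall>y\<in>X. C x (g x) y (g y))"
  using assms(1,2)
proof (induction X rule: finite_psubset_induct)
  case (psubset X)
  show ?case
  proof (cases "X = {a}")
    case True
    then show ?thesis using assms(3) refl by (intro exI[of _ "\<lambda>_. v"]) simp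
  next
    case False
    then obtain b n where b: "b \<in> X - {a}" and n: "n \<in> X - {b}"
      and between: "\<And>x. x \<in> X - {b} \<Longrightarrow> x \<le> n \<and> n \<le> b \<or> b \<le> n \<and> n \<le> x"
      using finite_chain_has_outer_neighbour[OF psubset(1) psubset.prems] by metis
    obtain g where g: "g a = v" "\<And>x. x \<in> X - {b} \<Longrightarrow> g x \<in> A x"
      "\<And>x y. x \<in> X - {b} \<Longrightarrow> y \<in> X - {b} \<Longrightarrow> C x (g x) y (g y)"
      using psubset.IH[of "X - {b}"] b psubset.prems by blast
    obtain w where w: "w \<in> A b" "C n (g n) b w" using step[OF g(2)[OF n]] by blast
    have C_b: "C x (g x) b w" if "x \<in> X - {b}" for x
      using between[OF that] trans[OF _ _ g(2)[OF that] g(2)[OF n] w(1) g(3)[OF that n] w(2)]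
        trans[OF _ _ w(1) g(2)[OF n] g(2)[OF that] sym[OF w(2)] g(3)[OF n that]] sym by blast
    then show ?thesis
      using b g w(1) refl sym by (intro exI[of _ "g(b := w)"]) auto
  qed
qed

context middle_exact_module
begin

definition compatible :: "real \<times> real \<Rightarrow> 'v \<Rightarrow> real \<times> real \<Rightarrow> 'v \<Rightarrow> bool" where
  "compatible q u r w \<longleftrightarrow> f q (join q r) u = f r (join q r) w"

lemma compatible_sym: "compatible q u r w \<Longrightarrow> compatible r w q u"
  by (simp add: compatible_def join_commute)

lemma compatible_above:
  assumes "compatible q u r w" "q \<in> Q" "r \<in> Q" "u \<in> V q" "w \<in> V r" "le2 q t" "le2 r t"
  shows "f q t u = f r t w"
proof -
  have "f q t u = f (join q r) t (f q (join q r) u)"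
    using assms by (simp add: map_comp join_le2_iff)
  also have "\<dots> = f (join q r) t (f r (join q r) w)" using assms(1) by (simp add: compatible_def)
  also have "\<dots> = f r t w" using assms by (simp add: map_comp join_le2_iff)
  finally show ?thesis .
qed

lemma compatible_trans:
  assumes "compatible p u q v" "compatible q v r w" "le2 q (join p r)"
    and "p \<in> Q" "q \<in> Q" "r \<in> Q" "u \<in> V p" "v \<in> V q" "w \<in> V r"
  shows "compatible p u r w"
  using compatible_above[of p u q v "join p r"] compatible_above[of q v r w "join p r"] assms
  by (simp add: compatible_def)

context
  fixes S :: "real \<times> real \<Rightarrow> 'v set"
  assumes S: "submodule S"
    and surj: "\<And>q r v. q \<in> Q \<Longrightarrow> le2 q r \<Longrightarrow> v \<in> S r \<Longrightarrow> \<exists>z\<in>S q. f q r z = v"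
begin

lemma exists_compatible:
  assumes "q \<in> Q" "r \<in> Q" "u \<in> S q"
  shows "\<exists>w\<in>S r. compatible q u r w"
proof -
  have "f q (join q r) u \<in> S (join q r)" by (rule submodule_map[OF S assms(1) _ assms(3)]) simp
  then obtain w where "w \<in> S r" "f r (join q r) w = f q (join q r) u"
    using surj[OF assms(2) le2_join(2)] by blast
  then show ?thesis unfolding compatible_def by metis
qed

lemma antidiagonal_section:
  assumes c: "\<And>x. (x, c - x) \<in> Q" and X: "finite X" "a \<in> X" and m: "m \<in> S (a, c - a)"
  shows "\<exists>g. g a = m \<and> (\<forall>x\<in>X. g x \<in> S (x, c - x)) \<and>
    (\<forall>x\<in>X. \<forall>y\<in>X. compatible (x, c - x) (g x) (y, c - y) (g y))"
proof (rule finite_chain_choice[OF X])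
  have S_V: "v \<in> V (x, c - x)" if "v \<in> S (x, c - x)" for x v
    using that c by (intro submodule_in[OF S])
  show "compatible (x, c - x) u (z, c - z) w"
    if "x \<le> y" "y \<le> z" "u \<in> S (x, c - x)" "v \<in> S (y, c - y)" "w \<in> S (z, c - z)"
      "compatible (x, c - x) u (y, c - y) v" "compatible (y, c - y) v (z, c - z) w" for x y z u v w
    using that c S_V by (intro compatible_trans[OF that(6,7)]) (auto simp: join_def)
qed (use m c exists_compatible compatible_sym in \<open>auto simp: compatible_def join_commute\<close>)

lemma finite_section:
  assumes F: "finite F" "F \<subseteq> Q" "p \<in> F" and m: "m \<in> S p"
  shows "\<exists>e. coherent S F e \<and> e p = m"
proof -
  obtain c where c: "\<And>x. (x, c - x) \<in> Q" "\<And>q. q \<in> F \<Longrightarrow> c \<le> fst q + snd q"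
    using antidiagonal[OF F(1,2)] by blast
  define \<alpha> where "\<alpha> q = (fst q, c - fst q)" for q :: "real \<times> real"
  have \<alpha>: "\<alpha> q \<in> Q" "le2 (\<alpha> q) q" if "q \<in> F" for q
    using c(1) c(2)[OF that] by (auto simp: \<alpha>_def le2_def)
  obtain m' where m': "m' \<in> S (\<alpha> p)" "f (\<alpha> p) p m' = m" using surj \<alpha>[OF F(3)] m by blast
  have "\<exists>g. g (fst p) = m' \<and> (\<forall>x\<in>fst ` F. g x \<in> S (x, c - x)) \<and>
      (\<forall>x\<in>fst ` F. \<forall>y\<in>fst ` F. compatible (x, c - x) (g x) (y, c - y) (g y))"
    using F m'(1) by (intro antidiagonal_section c(1)) (auto simp: \<alpha>_def)
  then obtain g where g: "g (fst p) = m'" "\<And>q. q \<in> F \<Longrightarrow> g (fst q) \<in> S (\<alpha> q)"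
    "\<And>q r. q \<in> F \<Longrightarrow> r \<in> F \<Longrightarrow> compatible (\<alpha> q) (g (fst q)) (\<alpha> r) (g (fst r))"
    by (auto simp: \<alpha>_def)
  have g_V: "g (fst q) \<in> V (\<alpha> q)" if "q \<in> F" for q
    using submodule_in[OF S \<alpha>(1)[OF that] g(2)[OF that]] .
  let ?e = "\<lambda>q. f (\<alpha> q) q (g (fst q))"
  have "coherent S F ?e"
    unfolding coherent_def
  proof (intro conjI ballI impI)
    show "?e q \<in> S q" if "q \<in> F" for q
      using submodule_map[OF S \<alpha>[OF that] g(2)[OF that]] .
    fix q r assume qr: "q \<in> F" "r \<in> F" "le2 q r"
    have "f q r (?e q) = f (\<alpha> q) r (g (fst q))" by (rule map_comp[OF \<alpha>[OF qr(1)] qr(3) g_V[OF qr(1)]])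
    also have "\<dots> = ?e r"
      using qr \<alpha> g_V le2_trans[OF \<alpha>(2)[OF qr(1)] qr(3)] by (intro compatible_above[OF g(3)])
    finally show "f q r (?e q) = ?e r" .
  qed
  then show ?thesis using m'(2) g(1) by auto
qed

lemma surjective_submodule_section:
  assumes "p \<in> Q" "m \<in> S p"
  obtains e where "coherent S Q e" "e p = m"
  using coherent_extension[OF S order_refl assms(1)] finite_section assms(2) by metis

end

section \<open>Death blocks\<close>

lemma dying_outside_TimesI:
  assumes "(x, y) \<in> Q" "v \<in> V (x, y)"
    and "\<And>a. x \<le> a \<Longrightarrow> a \<notin> A \<Longrightarrow> f (x, y) (a, y) v = 0" "\<And>b. y \<le> b \<Longrightarrow> b \<notin> B \<Longrightarrow> f (x, y) (x, b) v = 0"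
  shows "v \<in> dying_outside (A \<times> B) (x, y)"
proof -
  have "f (x, y) r v = 0" if r: "le2 (x, y) r" "r \<notin> A \<times> B" for r
  proof -
    obtain a b where ab: "r = (a, b)" "x \<le> a" "y \<le> b" using r(1) by (cases r) simp
    have "v \<in> kernel (x, y) (a, y) \<or> v \<in> kernel (x, y) (x, b)"
      using assms(2-4) ab r(2) by (auto simp: kernel_def)
    then show ?thesis
      using kernel_mono[OF assms(1), of "(a, y)" r] kernel_mono[OF assms(1), of "(x, b)" r] ab
      by (auto simp: kernel_def)
  qed
  then show ?thesis using assms(2) by (simp add: dying_outside_def)
qed

lemma least_kernel:
  assumes "(x, y) \<in> Q" "T \<noteq> {}" and T: "\<And>a. a \<in> T \<Longrightarrow> x \<le> a"
  obtains t where "t \<in> T" "\<And>a. a \<in> T \<Longrightarrow> kernel (x, y) (t, y) \<subseteq> kernel (x, y) (a, y)"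
proof -
  obtain B where B: "finite B" "V (x, y) \<subseteq> span B" using fin_dim[OF assms(1)] by blast
  show thesis
  proof (rule least_subspace_in_chain[OF B(1) assms(2), of "\<lambda>a. kernel (x, y) (a, y)"])
    show "subspace (kernel (x, y) (a, y)) \<and> kernel (x, y) (a, y) \<subseteq> span B" if "a \<in> T" for a
      using subspace_kernel[OF assms(1), of "(a, y)"] T[OF that] kernel_subset B(2) by force
    show "kernel (x, y) (a, y) \<subseteq> kernel (x, y) (b, y) \<or> kernel (x, y) (b, y) \<subseteq> kernel (x, y) (a, y)"
      if "a \<in> T" "b \<in> T" for a b
      using kernel_mono[OF assms(1), of "(a, y)" "(b, y)"] kernel_mono[OF assms(1), of "(b, y)" "(a, y)"]
        T that linear[of a b] by auto
  qed (rule that)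
qed

lemma dying_outside_lift_vertical:
  assumes A: "down_closed A" "t \<notin> A" and B: "down_closed B"
    and Q: "(x, y) \<in> Q" "y \<le> y'" and v: "v \<in> dying_outside (A \<times> B) (x, y')"
  obtains z where "z \<in> dying_outside (A \<times> B) (x, y)" "f (x, y) (x, y') z = v"
proof (cases "(x, y') \<in> A \<times> B")
  case False
  have "(x, y') \<in> Q" using upward[OF Q(1)] Q(2) by simp
  then have "v = 0" using dying_outsideD[OF v _ False] dying_outside_in[OF v] by simp
  moreover have "0 \<in> dying_outside (A \<times> B) (x, y)"
    by (rule subspace_0[OF submodule_subspace[OF submodule_dying_outside Q(1)]])
  ultimately show thesis using that Q by simp
next
  case True
  then have x: "x \<in> A" and y': "y' \<in> B" by auto
  have right: "x \<le> a" if "a \<notin> A" for a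
    using down_closedD[OF A(1) x, of a] that by linarith
  have above: "y' \<le> b" if "b \<notin> B" for b
    using down_closedD[OF B y', of b] that by linarith
  obtain t0 where t0: "t0 \<notin> A" "\<And>a. a \<notin> A \<Longrightarrow> kernel (x, y) (t0, y) \<subseteq> kernel (x, y) (a, y)"
    using least_kernel[OF Q(1), of "- A"] A(2) right by auto
  have Q': "(t0, y) \<in> Q" using upward[OF Q(1)] right[OF t0(1)] by simp
  have "f (x, y') (t0, y') v = f (t0, y) (t0, y') 0"
    using dying_outsideD[OF v, of "(t0, y')"] right[OF t0(1)] t0(1) Q(2) Q' by simp
  then obtain z where z: "z \<in> V (x, y)" "f (x, y) (x, y') z = v" "f (x, y) (t0, y) z = 0"
    using exact[OF Q(1) right[OF t0(1)] Q(2) dying_outside_in[OF v] zero_in[OF Q']] by blast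
  have "z \<in> dying_outside (A \<times> B) (x, y)"
  proof (rule dying_outside_TimesI[OF Q(1) z(1)])
    show "f (x, y) (a, y) z = 0" if "a \<notin> A" for a
      using t0(2)[OF that] z by (auto simp: kernel_def)
    show "f (x, y) (x, b) z = 0" if "b \<notin> B" for b
      using map_comp[OF Q(1), of "(x, y')" "(x, b)" z] dying_outsideD[OF v, of "(x, b)"]
        z above[OF that] that Q(2) by simp
  qed
  then show thesis using that z(2) by blast
qed

lemma dying_outside_lift_horizontal:
  assumes A: "down_closed A" and B: "down_closed B" "u \<notin> B"
    and Q: "(x, y) \<in> Q" "x \<le> x'" and v: "v \<in> dying_outside (A \<times> B) (x', y)"
  obtains z where "z \<in> dying_outside (A \<times> B) (x, y)" "f (x, y) (x', y) z = v"
proof -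
  interpret swap: middle_exact_module s "prod.swap -` Q" "V \<circ> prod.swap" "swap_maps f"
    by (rule swap_module)
  have swap_Times: "prod.swap -` (A \<times> B) = B \<times> A" by auto
  show thesis
    using swap.dying_outside_lift_vertical[OF B A, of y x x' v] Q v that
      swap_dying_outside[of "A \<times> B"] unfolding swap_Times by auto
qed

lemma dying_outside_lift:
  assumes A: "down_closed A" "t \<notin> A" and B: "down_closed B" "u \<notin> B"
    and Q: "q \<in> Q" "le2 q r" and v: "v \<in> dying_outside (A \<times> B) r"
  shows "\<exists>z\<in>dying_outside (A \<times> B) q. f q r z = v"
proof -
  obtain x y x' y' where qr: "q = (x, y)" "r = (x', y')" "x \<le> x'" "y \<le> y'"
    using Q(2) by (cases q, cases r) simp
  have Q': "(x, y') \<in> Q" using upward[OF Q(1)] qr by simp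
  obtain w where w: "w \<in> dying_outside (A \<times> B) (x, y')" "f (x, y') (x', y') w = v"
    using dying_outside_lift_horizontal[OF A(1) B Q' qr(3)] v qr(2) by blast
  obtain z where z: "z \<in> dying_outside (A \<times> B) (x, y)" "f (x, y) (x, y') z = w"
    using dying_outside_lift_vertical[OF A B(1) _ qr(4) w(1)] Q(1) qr(1) by blast
  have "f q r z = v"
    using map_comp[of q "(x, y')" r z] Q(1) qr z w dying_outside_in[OF z(1)] by simp
  then show ?thesis using z(1) qr(1) by blast
qed

definition death_block :: "real \<times> real \<Rightarrow> 'v \<Rightarrow> (real \<times> real) set" where
  "death_block p m = {a. m \<notin> hkernel p a} \<times> {b. m \<notin> vkernel p b}"

lemma down_closed_death_block_sides:
  assumes "p \<in> Q"
  shows "down_closed {a. m \<notin> hkernel p a}" "down_closed {b. m \<notin> vkernel p b}"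
  using hkernel_mono[OF assms] vkernel_mono[OF assms] unfolding down_closed_def by blast+

lemma in_death_block:
  assumes "p \<in> Q" "m \<noteq> 0"
  shows "p \<in> death_block p m"
  using hkernel_trivial[OF assms(1), of "fst p"] vkernel_trivial[OF assms(1), of "snd p"] assms(2)
  by (simp add: death_block_def mem_Times_iff)

lemma dying_outside_death_block:
  assumes "p \<in> Q" "m \<in> V p"
  shows "m \<in> dying_outside (death_block p m) p"
proof -
  obtain x y where p: "p = (x, y)" by (cases p)
  show ?thesis
    using assms unfolding death_block_def p
    by (intro dying_outside_TimesI) (auto simp: hkernel_def vkernel_def kernel_def max_absorb2)
qed

lemma kernel_rectangle:
  assumes "(x, y) \<in> Q" "x \<le> a" "y \<le> b" "v \<in> kernel (x, y) (a, b)"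
  obtains z where "z \<in> kernel (x, y) (a, y)" "v - z \<in> kernel (x, y) (x, b)"
proof -
  have v: "v \<in> V (x, y)" "f (x, y) (a, b) v = 0" using assms(4) by (auto simp: kernel_def)
  have v': "f (x, y) (x, b) v \<in> V (x, b)" using map_in assms(1,3) v(1) by simp
  have aQ: "(a, y) \<in> Q" using upward[OF assms(1)] assms(2) by simp
  have "f (x, b) (a, b) (f (x, y) (x, b) v) = f (a, y) (a, b) 0"
    using map_comp[OF assms(1), of "(x, b)" "(a, b)" v] v assms(2,3) aQ by simp
  then obtain z where z: "z \<in> V (x, y)" "f (x, y) (x, b) z = f (x, y) (x, b) v" "f (x, y) (a, y) z = 0"
    using exact[OF assms(1-3) v' zero_in[OF aQ]] by blast
  then show thesis
    using assms(1,3) v by (intro that[of z]) (auto simp: kernel_def diff_in map_diff)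
qed

text \<open>If \<open>m\<close> died inside the block, splitting it along the rectangle would produce a nonzero vector of
  shorter horizontal lifetime that still dies vertically before \<open>u\<close>.\<close>

lemma lives_on_death_block:
  assumes p: "p \<in> Q" and m: "m \<in> V p" "m \<in> vkernel p u"
    and least: "\<And>a. m \<in> hkernel p a \<or> hkernel p a \<inter> vkernel p u = {0}"
    and r: "r \<in> death_block p m" "le2 p r"
  shows "f p r m \<noteq> 0"
proof
  assume "f p r m = 0"
  obtain x y a b where xy: "p = (x, y)" "r = (a, b)" "x \<le> a" "y \<le> b"
    using r(2) by (cases p, cases r) simp
  have a: "m \<notin> hkernel p a" and b: "m \<notin> vkernel p b" using r(1) xy(2) by (auto simp: death_block_def)
  obtain z where "z \<in> kernel (x, y) (a, y)" "m - z \<in> kernel (x, y) (x, b)"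
    using kernel_rectangle[of x y a b m] p m(1) \<open>f p r m = 0\<close> xy by (auto simp: kernel_def)
  then have z: "z \<in> hkernel p a" "m - z \<in> vkernel p b"
    using xy by (simp_all add: hkernel_def vkernel_def max_absorb2)
  have "b \<le> u" using vkernel_mono[OF p, of u b] m(2) b by force
  then have "m - z \<in> vkernel p u" using vkernel_mono[OF p] z(2) by blast
  then have "m - (m - z) \<in> vkernel p u"
    by (rule subspace_diff[OF subspace_vkernel[OF p] m(2)])
  then have "z = 0" using least[of a] a z(1) by auto
  then show False using z(2) b by simp
qed

lemma death_section:
  assumes p: "p \<in> Q" and m: "m \<in> hkernel p t \<inter> vkernel p u"
  obtains e where "coherent (dying_outside (death_block p m)) Q e" "e p = m"
proof (rule surjective_submodule_section[OF submodule_dying_outside _ p])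
  show "\<exists>z\<in>dying_outside (death_block p m) q. f q r z = v"
    if "q \<in> Q" "le2 q r" "v \<in> dying_outside (death_block p m) r" for q r v
    using that m unfolding death_block_def
    by (intro dying_outside_lift[of _ t _ u] down_closed_death_block_sides[OF p]) auto
  show "m \<in> dying_outside (death_block p m) p"
    using m hkernel_in by (intro dying_outside_death_block[OF p]) blast
qed (rule that)

lemma block_summand_if_doubly_dying:
  assumes p: "p \<in> Q" and v: "v \<in> hkernel p t" "v \<in> vkernel p u" "v \<noteq> 0"
  shows "\<exists>t. block_summand t"
proof -
  obtain m where "m \<noteq> 0" and m: "m \<in> hkernel p t \<inter> vkernel p u"
    and least: "\<And>a. m \<in> hkernel p a \<inter> vkernel p u \<or> hkernel p a \<inter> vkernel p u = {0}"
  proof (rule exists_in_least_nonzero[OF p, of "\<lambda>a. hkernel p a \<inter> vkernel p u" t])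
    show "subspace (hkernel p a \<inter> vkernel p u)" for a
      by (rule subspace_inter[OF subspace_hkernel[OF p] subspace_vkernel[OF p]])
    show "hkernel p a \<inter> vkernel p u \<subseteq> V p" for a using hkernel_in by blast
    show "hkernel p a \<inter> vkernel p u \<subseteq> hkernel p b \<inter> vkernel p u \<or>
        hkernel p b \<inter> vkernel p u \<subseteq> hkernel p a \<inter> vkernel p u" for a b
      using hkernel_chain[OF p, of a b] by blast
  qed (use v in auto)
  have mV: "m \<in> V p" using m hkernel_in by blast
  obtain A B where AB: "death_block p m = A \<times> B" "down_closed A" "down_closed B"
    using down_closed_death_block_sides[OF p] by (metis death_block_def)
  have pAB: "p \<in> A \<times> B" using in_death_block[OF p \<open>m \<noteq> 0\<close>] AB(1) by simp
  obtain e where e: "coherent (dying_outside (A \<times> B)) Q e" "e p = m"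
    using death_section[OF p m] AB(1) by metis
  show ?thesis
  proof (rule block_summand_if_not_from_outside)
    show "is_block (A \<times> B)" using AB(2,3) pAB by (intro is_block_TimesI) auto
    show "p \<in> A \<times> B \<inter> Q" using pAB p by blast
    show "coherent V (A \<times> B \<inter> Q) e"
      using e(1) dying_outside_in by (auto simp: coherent_def)
    show "f q r (e q) = 0" if "q \<in> A \<times> B \<inter> Q" "le2 q r" "r \<notin> A \<times> B" for q r
      using dying_outsideD[OF coherent_in[OF e(1)]] that by blast
    show "f p r (e p) \<notin> from_outside (A \<times> B) r" if r: "r \<in> A \<times> B" "le2 p r" for r
    proof -
      have "from_outside (A \<times> B) r = {0}"
        using r(1) AB(2,3)
        by (intro from_outside_down_closed) (auto simp: le2_def mem_Times_iff intro: down_closedD)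
      then show ?thesis
        using lives_on_death_block[OF p mV, of u r] m least r e(2) AB(1) by auto
    qed
  qed
qed

section \<open>Vectors arriving from the left\<close>

text \<open>The column over \<open>a\<close> need not reach \<open>Q\<close> at the height of \<open>p\<close>, so vectors at \<open>p\<close> are compared
  with it after moving upwards.\<close>

definition left_image :: "real \<times> real \<Rightarrow> real \<Rightarrow> 'v set" where
  "left_image p a = {v \<in> V p. \<forall>\<^sub>F Y in at_top.
     f p (max (fst p) a, Y) v \<in> f (a, Y) (max (fst p) a, Y) ` V (a, Y)}"

lemma left_image_in: "v \<in> left_image p a \<Longrightarrow> v \<in> V p"
  by (simp add: left_image_def)

lemma eventually_column_in: "\<forall>\<^sub>F Y in at_top. (a, Y) \<in> Q"
proof -
  obtain c where "(a, c - a) \<in> Q" using antidiagonal[of "{}"] by auto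
  then have "(a, Y) \<in> Q" if "c - a \<le> Y" for Y using upward[of "(a, c - a)" "(a, Y)"] that by simp
  then show ?thesis by (auto simp: eventually_at_top_linorder)
qed

lemma left_imageI:
  assumes p: "p \<in> Q" and v: "v \<in> V p" and w: "(a, Y) \<in> Q" "snd p \<le> Y" "w \<in> V (a, Y)"
    and vw: "f p (max (fst p) a, Y) v = f (a, Y) (max (fst p) a, Y) w"
  shows "v \<in> left_image p a"
proof -
  let ?X = "max (fst p) a"
  have "f p (?X, Z) v = f (a, Z) (?X, Z) (f (a, Y) (a, Z) w)" if "Y \<le> Z" for Z
  proof -
    have "f p (?X, Z) v = f (?X, Y) (?X, Z) (f p (?X, Y) v)"
      using p v w(2) that by (simp add: map_comp le2_def)
    also have "\<dots> = f (a, Z) (?X, Z) (f (a, Y) (a, Z) w)"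
      unfolding vw using w that by (intro map_square) auto
    finally show ?thesis .
  qed
  moreover have "f (a, Y) (a, Z) w \<in> V (a, Z)" if "Y \<le> Z" for Z
    using map_in[OF w(1) _ w(3)] that by simp
  ultimately have "\<forall>\<^sub>F Z in at_top. f p (?X, Z) v \<in> f (a, Z) (?X, Z) ` V (a, Z)"
    unfolding eventually_at_top_linorder by blast
  then show ?thesis using v by (simp add: left_image_def)
qed

lemma left_imageE:
  assumes p: "p \<in> Q" and v: "v \<in> left_image p a"
  obtains Y w where "b \<le> Y" "snd p \<le> Y" "(a, Y) \<in> Q" "w \<in> V (a, Y)"
    "\<And>X. fst p \<le> X \<Longrightarrow> a \<le> X \<Longrightarrow> f p (X, Y) v = f (a, Y) (X, Y) w"
proof -
  let ?X = "max (fst p) a"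
  have "\<forall>\<^sub>F Y in at_top. b \<le> Y \<and> snd p \<le> Y \<and> (a, Y) \<in> Q \<and> f p (?X, Y) v \<in> f (a, Y) (?X, Y) ` V (a, Y)"
    using v by (intro eventually_conj eventually_ge_at_top eventually_column_in) (simp add: left_image_def)
  then obtain Y where Y: "b \<le> Y" "snd p \<le> Y" "(a, Y) \<in> Q" "f p (?X, Y) v \<in> f (a, Y) (?X, Y) ` V (a, Y)"
    unfolding eventually_at_top_linorder by blast
  then obtain w where w: "w \<in> V (a, Y)" "f p (?X, Y) v = f (a, Y) (?X, Y) w" by blast
  have "f p (X, Y) v = f (a, Y) (X, Y) w" if "fst p \<le> X" "a \<le> X" for X
  proof -
    have "f p (X, Y) v = f (?X, Y) (X, Y) (f p (?X, Y) v)"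
      using p left_image_in[OF v] Y(2) that by (simp add: map_comp le2_def)
    also have "\<dots> = f (a, Y) (X, Y) w"
      unfolding w(2) using Y(3) w(1) that by (simp add: map_comp)
    finally show ?thesis .
  qed
  then show thesis by (rule that[OF Y(1-3) w(1)])
qed

lemma subspace_left_image:
  assumes p: "p \<in> Q"
  shows "subspace (left_image p a)"
proof -
  define im where "im Y = f (a, Y) (max (fst p) a, Y) ` V (a, Y)" for Y
  have im: "\<forall>\<^sub>F Y in at_top. snd p \<le> Y \<and> subspace (im Y)"
    using eventually_ge_at_top[of "snd p"] eventually_column_in[of a]
    by eventually_elim (simp add: im_def subspace_map_image)
  have le: "le2 p (max (fst p) a, Y)" if "snd p \<le> Y" for Y using that by (simp add: le2_def)
  have left_image: "left_image p a = {v \<in> V p. \<forall>\<^sub>F Y in at_top. f p (max (fst p) a, Y) v \<in> im Y}"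
    by (simp add: left_image_def im_def)
  show ?thesis
    unfolding left_image
  proof (rule subspaceI; safe)
    show "\<forall>\<^sub>F Y in at_top. f p (max (fst p) a, Y) 0 \<in> im Y"
      using im by eventually_elim (use p le in \<open>simp add: subspace_0\<close>)
    fix v assume v: "v \<in> V p" "\<forall>\<^sub>F Y in at_top. f p (max (fst p) a, Y) v \<in> im Y"
    show "\<forall>\<^sub>F Y in at_top. f p (max (fst p) a, Y) (s c v) \<in> im Y" for c
      using im v(2) by eventually_elim (use p le v(1) in \<open>simp add: map_scale subspace_scale\<close>)
    show "\<forall>\<^sub>F Y in at_top. f p (max (fst p) a, Y) (v + w) \<in> im Y"
      if "w \<in> V p" "\<forall>\<^sub>F Y in at_top. f p (max (fst p) a, Y) w \<in> im Y" for w
      using im v(2) that(2) by eventually_elim (use p le v(1) that(1) in \<open>simp add: map_add subspace_add\<close>)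
  qed (use p in \<open>auto intro: add_in scale_in\<close>)
qed

lemma left_image_mono:
  assumes p: "p \<in> Q" and "a \<le> b"
  shows "left_image p a \<subseteq> left_image p b"
proof
  fix v assume v: "v \<in> left_image p a"
  obtain Y w where Y: "snd p \<le> Y" "(a, Y) \<in> Q" "w \<in> V (a, Y)"
    "\<And>X. fst p \<le> X \<Longrightarrow> a \<le> X \<Longrightarrow> f p (X, Y) v = f (a, Y) (X, Y) w"
    using left_imageE[OF p v] by metis
  show "v \<in> left_image p b"
  proof (rule left_imageI[OF p left_image_in[OF v] _ Y(1)])
    show "(b, Y) \<in> Q" using upward[OF Y(2)] \<open>a \<le> b\<close> by simp
    show "f (a, Y) (b, Y) w \<in> V (b, Y)" using map_in[OF Y(2) _ Y(3)] \<open>a \<le> b\<close> by simp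
    show "f p (max (fst p) b, Y) v = f (b, Y) (max (fst p) b, Y) (f (a, Y) (b, Y) w)"
      using Y(2-4) \<open>a \<le> b\<close> by (simp add: map_comp max.coboundedI2)
  qed
qed

lemma left_image_full:
  assumes p: "p \<in> Q" and "fst p \<le> a"
  shows "left_image p a = V p"
proof -
  have "v \<in> left_image p (fst p)" if "v \<in> V p" for v
    using p that by (intro left_imageI[of p v _ "snd p" v]) auto
  then show ?thesis using left_image_mono[OF assms] left_image_in by blast
qed

definition from_left :: "real set \<Rightarrow> real \<times> real \<Rightarrow> 'v set" where
  "from_left A r = insert 0 (\<Union>a\<in>{a. a \<le> fst r \<and> a \<notin> A \<and> (a, snd r) \<in> Q}. f (a, snd r) r ` V (a, snd r))"

lemma from_left_map_in:
  assumes "q \<in> Q" "fst q \<notin> A" "le2 q r" "v \<in> V q"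
  shows "f q r v \<in> from_left A r"
proof -
  let ?q = "(fst q, snd r)"
  have le: "le2 q ?q" "le2 ?q r" using assms(3) by (auto simp: le2_def)
  have "f q r v = f ?q r (f q ?q v)" using assms(1,4) le by (simp add: map_comp)
  then show ?thesis
    using map_in[OF assms(1) le(1) assms(4)] upward[OF assms(1) le(1)] assms(2) le(2)
    by (auto simp: from_left_def le2_def)
qed

lemma subspace_from_left:
  assumes r: "r \<in> Q"
  shows "subspace (from_left A r)"
proof -
  define I where "I = {a. a \<le> fst r \<and> a \<notin> A \<and> (a, snd r) \<in> Q}"
  define image where "image a = f (a, snd r) r ` V (a, snd r)" for a
  have le: "le2 (a, snd r) r" if "a \<in> I" for a using that by (simp add: I_def le2_def)
  have mono: "image a \<subseteq> image b" if ab: "a \<in> I" "b \<in> I" "a \<le> b" for a b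
  proof -
    have "f (a, snd r) r w = f (b, snd r) r (f (a, snd r) (b, snd r) w)"
      "f (a, snd r) (b, snd r) w \<in> V (b, snd r)" if "w \<in> V (a, snd r)" for w
      using ab that le[OF ab(2)] by (auto simp: map_comp I_def intro!: map_in)
    then show ?thesis unfolding image_def by blast
  qed
  have chain: "image a \<subseteq> image b \<or> image b \<subseteq> image a" if "a \<in> I" "b \<in> I" for a b
    using mono[OF that] mono[OF that(2,1)] linear[of a b] by blast
  have "subspace (\<Union>(insert {0} (image ` I)))"
  proof (rule subspace_Union_chain)
    have subspace_image: "subspace (image a)" if "a \<in> I" for a
      using subspace_map_image[OF _ le[OF that]] that by (simp add: image_def I_def)
    show "subspace S" if "S \<in> insert {0} (image ` I)" for S
      using that subspace_image by auto
    show "S \<subseteq> T \<or> T \<subseteq> S" if "S \<in> insert {0} (image ` I)" "T \<in> insert {0} (image ` I)" for S T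
      using that chain subspace_0[OF subspace_image] by blast
  qed simp
  moreover have "from_left A r = \<Union>(insert {0} (image ` I))" by (auto simp: from_left_def image_def I_def)
  ultimately show ?thesis by simp
qed

lemma from_outside_vertical_band_subset:
  assumes "r \<in> Q"
  shows "from_outside (A \<times> UNIV) r \<subseteq> from_left A r"
  unfolding from_outside_def
proof (rule span_minimal[OF _ subspace_from_left[OF assms]])
  show "(\<Union>q\<in>{q \<in> Q - A \<times> UNIV. le2 q r}. f q r ` V q) \<subseteq> from_left A r"
    by (intro UN_least image_subsetI from_left_map_in) (auto simp: mem_Times_iff)
qed

text \<open>By convexity, everything that reaches \<open>(X, Y)\<close> from the left of \<open>A\<close> passes through the column
  over \<open>x\<close>.\<close>

lemma from_left_factor:
  assumes p: "(x, y) \<in> Q" "x \<le> X" "y \<le> Y" and A: "ord_convex A" "x \<in> A" "X \<in> A"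
    and v: "v \<in> from_left A (X, Y)"
  obtains w where "w \<in> V (x, Y)" "f (x, Y) (X, Y) w = v"
    "\<And>z. z \<in> V (x, y) \<Longrightarrow> f (x, y) (x, Y) z = w \<Longrightarrow>
      z \<in> kernel (x, y) (x, Y) \<or> (\<exists>a<x. a \<notin> A \<and> z \<in> left_image (x, y) a)"
proof -
  have xQ: "(x, Y) \<in> Q" using upward[OF p(1)] p(3) by simp
  consider "v = 0" | a u where "a \<le> X" "a \<notin> A" "(a, Y) \<in> Q" "u \<in> V (a, Y)" "v = f (a, Y) (X, Y) u"
    using v by (auto simp: from_left_def)
  then show thesis
  proof cases
    case 1
    show thesis by (rule that[of 0]) (use 1 p(2) xQ in \<open>auto simp: kernel_def\<close>)
  next
    case (2 a u)
    have "a < x"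
      using A 2(1,2) unfolding ord_convex_def by (metis linorder_not_le)
    show thesis
    proof (rule that[of "f (a, Y) (x, Y) u"])
      show "f (a, Y) (x, Y) u \<in> V (x, Y)" using 2(3,4) \<open>a < x\<close> by (intro map_in) auto
      show "f (x, Y) (X, Y) (f (a, Y) (x, Y) u) = v" using 2(3-5) \<open>a < x\<close> p(2) by (simp add: map_comp)
      show "z \<in> kernel (x, y) (x, Y) \<or> (\<exists>a<x. a \<notin> A \<and> z \<in> left_image (x, y) a)"
        if z: "z \<in> V (x, y)" "f (x, y) (x, Y) z = f (a, Y) (x, Y) u" for z
      proof -
        have "z \<in> left_image (x, y) a"
          by (rule left_imageI[OF p(1) z(1) 2(3) _ 2(4)])
            (use p(3) \<open>a < x\<close> z(2) in \<open>auto simp: max_absorb1\<close>)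
        then show ?thesis using 2(2) \<open>a < x\<close> by blast
      qed
    qed
  qed
qed

section \<open>Bands\<close>

definition hdying :: "real \<times> real \<Rightarrow> 'v set" where
  "hdying q = (\<Union>a. hkernel q a)"

lemma hdying_in: "v \<in> hdying q \<Longrightarrow> v \<in> V q"
  by (auto simp: hdying_def hkernel_in)

lemma hdyingI: "v \<in> V (x, y) \<Longrightarrow> x \<le> a \<Longrightarrow> f (x, y) (a, y) v = 0 \<Longrightarrow> v \<in> hdying (x, y)"
  by (auto simp: hdying_def hkernel_def kernel_def intro!: exI[of _ a])

lemma hdyingE:
  assumes "v \<in> hdying (x, y)"
  obtains a where "x \<le> a" "f (x, y) (a, y) v = 0"
proof -
  obtain a where "f (x, y) (max x a, y) v = 0" using assms by (auto simp: hdying_def hkernel_def kernel_def)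
  then show thesis by (rule that[rotated]) simp
qed

lemma submodule_hdying: "submodule hdying"
  unfolding submodule_def
proof (intro ballI conjI allI impI)
  fix q assume q: "q \<in> Q"
  show "subspace (hdying q)"
    unfolding hdying_def using hkernel_chain[OF q] subspace_hkernel[OF q]
    by (intro subspace_Union_chain) auto
  show "hdying q \<subseteq> V q" using hdying_in by blast
  fix r assume r: "le2 q r"
  have "f q r v \<in> hkernel r a" if v: "v \<in> hkernel q a" for v a
  proof -
    have "le2 (max (fst q) a, snd q) (max (fst r) a, snd r)"
      using r by (auto simp: le2_def intro: max.coboundedI1)
    then have "v \<in> kernel q (max (fst r) a, snd r)"
      using kernel_mono[OF q, of "(max (fst q) a, snd q)" "(max (fst r) a, snd r)"] v
      by (auto simp: hkernel_def le2_def)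
    then show ?thesis
      using q r by (auto simp: hkernel_def kernel_def map_in map_comp le2_def)
  qed
  then show "f q r ` hdying q \<subseteq> hdying r" unfolding hdying_def by blast
qed

lemma zero_in_hdying: "q \<in> Q \<Longrightarrow> 0 \<in> hdying q"
  by (rule subspace_0[OF submodule_subspace[OF submodule_hdying]])

lemma hdying_if_map_hdying:
  assumes "(x, y) \<in> Q" "x \<le> x'" "w \<in> V (x, y)" "f (x, y) (x', y) w \<in> hdying (x', y)"
  shows "w \<in> hdying (x, y)"
proof -
  obtain a where "x' \<le> a" "f (x', y) (a, y) (f (x, y) (x', y) w) = 0"
    using assms(4) by (rule hdyingE)
  then show ?thesis using assms(1-3) by (intro hdyingI[of w x y a]) (auto simp: map_comp)
qed

lemma hdying_lift_vertical:
  assumes "(x, y) \<in> Q" "y \<le> y'" and w: "w \<in> hdying (x, y')"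
  obtains z where "z \<in> hdying (x, y)" "f (x, y) (x, y') z = w"
proof -
  obtain a where a: "x \<le> a" "f (x, y') (a, y') w = 0" using w by (rule hdyingE)
  have aQ: "(a, y) \<in> Q" using upward[OF assms(1)] a(1) by simp
  then have "f (x, y') (a, y') w = f (a, y) (a, y') 0" using a(2) assms(2) by simp
  then obtain z where "z \<in> V (x, y)" "f (x, y) (x, y') z = w" "f (x, y) (a, y) z = 0"
    using exact[OF assms(1) a(1) assms(2) hdying_in[OF w] zero_in[OF aQ]] by blast
  then show thesis using that a(1) hdyingI by blast
qed

definition lifespan :: "real \<times> real \<Rightarrow> 'v \<Rightarrow> real set" where
  "lifespan p m = {a. m \<in> left_image p a \<and> m \<notin> hkernel p a}"

lemma ord_convex_lifespan:
  assumes "p \<in> Q"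
  shows "ord_convex (lifespan p m)"
  using left_image_mono[OF assms] hkernel_mono[OF assms] unfolding ord_convex_def lifespan_def by blast

lemma fst_in_lifespan: "p \<in> Q \<Longrightarrow> m \<in> V p \<Longrightarrow> m \<noteq> 0 \<Longrightarrow> fst p \<in> lifespan p m"
  by (simp add: lifespan_def left_image_full hkernel_trivial)

context
  assumes vertical_inj: "\<And>q w b. q \<in> Q \<Longrightarrow> w \<in> hdying q \<Longrightarrow> w \<in> vkernel q b \<Longrightarrow> w = 0"
begin

lemma hdying_vertical_inj:
  assumes q: "q \<in> Q" "snd q \<le> Y" and z: "z \<in> hdying q" "w \<in> hdying q" "f q (fst q, Y) z = f q (fst q, Y) w"
  shows "z = w"
proof -
  have "z - w \<in> hdying q"
    using submodule_subspace[OF submodule_hdying q(1)] z(1,2) by (rule subspace_diff)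
  moreover have "z - w \<in> vkernel q Y"
    using q z hdying_in by (simp add: vkernel_def kernel_def le2_def map_diff diff_in max_absorb2)
  ultimately show ?thesis using vertical_inj[OF q(1)] by fastforce
qed

context
  fixes x y :: real and m :: 'v
  assumes p: "(x, y) \<in> Q" and m: "m \<in> hdying (x, y)" "m \<noteq> 0"
    and least: "\<And>a. m \<in> hkernel (x, y) a \<or> hkernel (x, y) a = {0}"
begin

abbreviation band :: "(real \<times> real) set" where
  "band \<equiv> lifespan (x, y) m \<times> UNIV"

lemma x_in_lifespan: "x \<in> lifespan (x, y) m"
  using fst_in_lifespan[OF p hdying_in[OF m(1)] m(2)] by simp

lemma hdying_lives_on_band:
  assumes "(X, Y) \<in> band" "x \<le> X" "y \<le> Y" "z \<in> hdying (x, y)" "f (x, y) (X, Y) z = 0"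
  shows "z = 0"
proof -
  have XQ: "(X, y) \<in> Q" using upward[OF p] assms(2) by simp
  have "f (x, y) (X, y) z \<in> hdying (X, y)"
    using submodule_map[OF submodule_hdying p _ assms(4)] assms(2) by simp
  moreover have "f (X, y) (X, Y) (f (x, y) (X, y) z) = f (X, y) (X, Y) 0"
    using map_comp[OF p, of "(X, y)" "(X, Y)" z] assms hdying_in XQ by simp
  ultimately have "f (x, y) (X, y) z = 0"
    using hdying_vertical_inj[OF XQ _ _ zero_in_hdying[OF XQ], of Y] assms(3) by simp
  then have "z \<in> hkernel (x, y) X"
    using assms(2,4) hdying_in by (simp add: hkernel_eq_kernel kernel_def)
  then show "z = 0" using least[of X] assms(1) by (auto simp: lifespan_def)
qed

lemma band_finite_section:
  assumes F: "finite F" "F \<subseteq> band \<inter> Q" "(x, y) \<in> F"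
  shows "\<exists>e. coherent hdying F e \<and> e (x, y) = m"
proof -
  define a where "a = Min (fst ` F)"
  have "a \<in> fst ` F" unfolding a_def using F by (intro Min_in) auto
  then have m_a: "m \<in> left_image (x, y) a" using F(2) by (auto simp: lifespan_def)
  have a_le: "a \<le> fst q" if "q \<in> F" for q unfolding a_def using F(1) that by simp
  obtain Y w where Y: "Max (snd ` F) \<le> Y" "(a, Y) \<in> Q" "w \<in> V (a, Y)"
    "f (x, y) (x, Y) m = f (a, Y) (x, Y) w"
    using left_imageE[OF p m_a, of "Max (snd ` F)"] a_le[OF F(3)] by (metis fst_conv order_refl)
  have le_Y: "snd q \<le> Y" if "q \<in> F" for q
    using Y(1) F(1) that by (meson Max_ge finite_imageI imageI order_trans)
  have "f (x, y) (x, Y) m \<in> hdying (x, Y)"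
    using submodule_map[OF submodule_hdying p _ m(1)] le_Y[OF F(3)] by simp
  then have w: "w \<in> hdying (a, Y)"
    using hdying_if_map_hdying[OF Y(2) _ Y(3)] a_le[OF F(3)] Y(4) by simp
  have "\<exists>z\<in>hdying q. f q (fst q, Y) z = f (a, Y) (fst q, Y) w" if q: "q \<in> F" for q
  proof -
    have "(fst q, snd q) \<in> Q" using q F(2) by auto
    moreover have "f (a, Y) (fst q, Y) w \<in> hdying (fst q, Y)"
      using submodule_map[OF submodule_hdying Y(2) _ w] a_le[OF q] by simp
    ultimately show ?thesis using hdying_lift_vertical[OF _ le_Y[OF q]] by (metis prod.collapse)
  qed
  then obtain e where e: "\<And>q. q \<in> F \<Longrightarrow> e q \<in> hdying q"
    "\<And>q. q \<in> F \<Longrightarrow> f q (fst q, Y) (e q) = f (a, Y) (fst q, Y) w" by metis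
  have "f q r (e q) = e r" if qr: "q \<in> F" "r \<in> F" "le2 q r" for q r
  proof (rule hdying_vertical_inj[OF _ le_Y[OF qr(2)] _ e(1)[OF qr(2)]])
    have q: "q \<in> Q" using qr(1) F(2) by blast
    show "r \<in> Q" using qr(2) F(2) by blast
    show "f q r (e q) \<in> hdying r" by (rule submodule_map[OF submodule_hdying q qr(3) e(1)[OF qr(1)]])
    have "f r (fst r, Y) (f q r (e q)) = f (fst q, Y) (fst r, Y) (f q (fst q, Y) (e q))"
      using q qr(3) le_Y[OF qr(1)] le_Y[OF qr(2)] hdying_in[OF e(1)[OF qr(1)]]
      by (intro map_square) (auto simp: le2_def)
    also have "\<dots> = f (a, Y) (fst r, Y) w"
      unfolding e(2)[OF qr(1)] using Y(2,3) a_le[OF qr(1)] qr(3) by (intro map_comp) (auto simp: le2_def)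
    finally show "f r (fst r, Y) (f q r (e q)) = f r (fst r, Y) (e r)" using e(2)[OF qr(2)] by simp
  qed
  moreover have "e (x, y) = m"
    using e[OF F(3)] Y(4) le_Y[OF F(3)] by (intro hdying_vertical_inj[OF p _ _ m(1)]) auto
  ultimately show ?thesis using e(1) unfolding coherent_def by blast
qed

lemma band_section:
  obtains e where "coherent hdying (band \<inter> Q) e" "e (x, y) = m"
proof (rule coherent_extension[OF submodule_hdying, of "band \<inter> Q" "(x, y)"])
  show "(x, y) \<in> band \<inter> Q" using x_in_lifespan p by simp
qed (use band_finite_section that in auto)

lemma dies_right_of_band:
  assumes e: "coherent hdying (band \<inter> Q) e" "e (x, y) = m" and q: "q \<in> band \<inter> Q" and r: "le2 q r" "r \<notin> band"
  shows "f q r (e q) = 0"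
proof -
  let ?j = "join q (x, y)" and ?top = "(fst r, max (snd r) y)"
  have rQ: "r \<in> Q" using q r(1) upward by blast
  have j: "?j \<in> band \<inter> Q"
    using join_in_Times[of q "lifespan (x, y) m" UNIV "(x, y)"] q x_in_lifespan upward[of q ?j] by simp
  have xr: "x \<le> fst r"
    using ord_convex_lifespan[OF p, of m] x_in_lifespan q r unfolding ord_convex_def
    by (metis IntD1 SigmaE UNIV_I fst_conv le2_def linorder_le_cases mem_Times_iff)
  then have "f (x, y) (fst r, y) m = 0"
    using r(2) left_image_full[OF p, of "fst r"] hdying_in[OF m(1)]
    by (auto simp: lifespan_def hkernel_eq_kernel kernel_def mem_Times_iff)
  have "f r ?top (f q r (e q)) = f ?j ?top (f q ?j (e q))"
    using q r xr hdying_in[OF coherent_in[OF e(1) q]] by (intro map_square) (auto simp: le2_def join_def)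
  also have "f q ?j (e q) = f (x, y) ?j m"
    using coherent_map[OF e(1) q j] coherent_map[OF e(1) _ j, of "(x, y)"] e(2) p x_in_lifespan by simp
  also have "f ?j ?top (f (x, y) ?j m) = f (fst r, y) ?top (f (x, y) (fst r, y) m)"
    using p xr r(1) hdying_in[OF m(1)] by (intro map_square) (auto simp: le2_def join_def)
  also have "\<dots> = f r ?top 0"
    using upward[OF p, of "(fst r, y)"] rQ xr \<open>f (x, y) (fst r, y) m = 0\<close> by (simp add: le2_def)
  finally have "f r ?top (f q r (e q)) = f r ?top 0" .
  moreover have "f q r (e q) \<in> hdying r"
    using submodule_map[OF submodule_hdying _ r(1) coherent_in[OF e(1) q]] q by simp
  ultimately show ?thesis
    using hdying_vertical_inj[OF rQ _ _ zero_in_hdying[OF rQ], of "snd ?top" "f q r (e q)"] by simp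
qed

lemma not_from_outside_band:
  assumes r: "(X, Y) \<in> band" "x \<le> X" "y \<le> Y"
  shows "f (x, y) (X, Y) m \<notin> from_outside band (X, Y)"
proof
  have Q: "(x, Y) \<in> Q" "(X, Y) \<in> Q" using upward[OF p] r(2,3) by auto
  have mV: "m \<in> V (x, y)" by (rule hdying_in[OF m(1)])
  assume "f (x, y) (X, Y) m \<in> from_outside band (X, Y)"
  then have "f (x, y) (X, Y) m \<in> from_left (lifespan (x, y) m) (X, Y)"
    using from_outside_vertical_band_subset[OF Q(2)] by blast
  then obtain w where w: "w \<in> V (x, Y)" "f (x, Y) (X, Y) w = f (x, y) (X, Y) m" and from_left:
    "\<And>z. z \<in> V (x, y) \<Longrightarrow> f (x, y) (x, Y) z = w \<Longrightarrow> z \<in> kernel (x, y) (x, Y) \<or>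
      (\<exists>a<x. a \<notin> lifespan (x, y) m \<and> z \<in> left_image (x, y) a)"
    using from_left_factor[OF p r(2,3) ord_convex_lifespan[OF p] x_in_lifespan] r(1) by blast
  let ?d = "f (x, y) (x, Y) m - w"
  have d: "?d \<in> V (x, Y)" using Q(1) map_in[OF p _ mV] w(1) r(3) by (simp add: diff_in)
  moreover have d0: "f (x, Y) (X, Y) ?d = 0"
    using Q(1) map_in[OF p _ mV] w r mV p by (simp add: map_diff map_comp)
  ultimately have "?d \<in> hdying (x, Y)" using r(2) by (intro hdyingI)
  then obtain z where z: "z \<in> hdying (x, y)" "f (x, y) (x, Y) z = ?d"
    by (rule hdying_lift_vertical[OF p r(3)])
  have "f (x, y) (X, Y) z = 0"
    using map_comp[OF p, of "(x, Y)" "(X, Y)" z] d0 z hdying_in r(2,3) by simp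
  then have "z = 0" by (rule hdying_lives_on_band[OF r z(1)])
  then have "f (x, y) (x, Y) m = w" using z(2) p r(3) by simp
  then consider "m \<in> kernel (x, y) (x, Y)"
    | a where "a < x" "a \<notin> lifespan (x, y) m" "m \<in> left_image (x, y) a"
    using from_left[OF mV] by blast
  then show False
  proof cases
    case 1
    then have "m \<in> vkernel (x, y) Y" using r(3) by (simp add: vkernel_def max_absorb2)
    then show False using vertical_inj[OF p m(1)] m(2) by blast
  next
    case 2
    then show False using hkernel_trivial[OF p, of a] m(2) by (simp add: lifespan_def)
  qed
qed

end

text \<open>If nothing dies in both directions, the vertical maps restrict to isomorphisms between the
  spaces of horizontally dying vectors, so these form a one-parameter module.\<close>

lemma block_summand_if_horizontally_dying:
  assumes p: "p \<in> Q" and v: "v \<in> hdying p" "v \<noteq> 0"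
  shows "\<exists>t. block_summand t"
proof -
  obtain x y where xy: "p = (x, y)" by (cases p)
  have pQ: "(x, y) \<in> Q" using p xy by simp
  obtain t where "v \<in> hkernel (x, y) t" using v(1) xy by (auto simp: hdying_def)
  then have nonzero: "hkernel (x, y) t \<noteq> {0}" using v(2) by blast
  obtain m where m: "m \<noteq> 0" "m \<in> hkernel (x, y) t" "\<And>a. m \<in> hkernel (x, y) a \<or> hkernel (x, y) a = {0}"
  proof (rule exists_in_least_nonzero[OF pQ, of "hkernel (x, y)" t])
    show "hkernel (x, y) a \<subseteq> V (x, y)" for a using hkernel_in by blast
  qed (rule nonzero subspace_hkernel[OF pQ] hkernel_chain[OF pQ] that)+
  have mh: "m \<in> hdying (x, y)" using m(2) by (auto simp: hdying_def)
  let ?I = "lifespan (x, y) m"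
  obtain e where e: "coherent hdying (?I \<times> UNIV \<inter> Q) e" "e (x, y) = m"
    by (rule band_section[OF pQ mh m(1,3)])
  have xI: "x \<in> ?I" by (rule x_in_lifespan[OF pQ mh m(1,3)])
  show ?thesis
  proof (rule block_summand_if_not_from_outside)
    show "is_block (?I \<times> UNIV)"
      using xI ord_convex_lifespan[OF pQ] by (intro is_block_TimesI) auto
    show "(x, y) \<in> ?I \<times> UNIV \<inter> Q" using xI pQ by simp
    show "coherent V (?I \<times> UNIV \<inter> Q) e" using e(1) hdying_in by (auto simp: coherent_def)
    show "f q r (e q) = 0" if "q \<in> ?I \<times> UNIV \<inter> Q" "le2 q r" "r \<notin> ?I \<times> UNIV" for q r
      by (rule dies_right_of_band[OF pQ mh m(1,3) e that])
    show "f (x, y) r (e (x, y)) \<notin> from_outside (?I \<times> UNIV) r" if "r \<in> ?I \<times> UNIV" "le2 (x, y) r" for r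
      using not_from_outside_band[OF pQ mh m(1,3), of "fst r" "snd r"] that e(2) by (cases r) auto
  qed
qed

end

end

section \<open>Birth blocks\<close>

context middle_exact_module
begin

interpretation swap: middle_exact_module s "prod.swap -` Q" "V \<circ> prod.swap" "swap_maps f"
  by (rule swap_module)

definition lower_image :: "real \<times> real \<Rightarrow> real \<Rightarrow> 'v set" where
  "lower_image p b = swap.left_image (prod.swap p) b"

definition from_below :: "real set \<Rightarrow> real \<times> real \<Rightarrow> 'v set" where
  "from_below B r = swap.from_left B (prod.swap r)"

lemma lower_image_mono: "p \<in> Q \<Longrightarrow> b \<le> b' \<Longrightarrow> lower_image p b \<subseteq> lower_image p b'"
  unfolding lower_image_def by (rule swap.left_image_mono) simp_all

lemma lower_image_full: "p \<in> Q \<Longrightarrow> snd p \<le> b \<Longrightarrow> lower_image p b = V p"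
  using swap.left_image_full[of "prod.swap p" b] by (simp add: lower_image_def)

lemma lower_imageE:
  assumes p: "p \<in> Q" and v: "v \<in> lower_image p b"
  obtains X w where "a \<le> X" "fst p \<le> X" "(X, b) \<in> Q" "w \<in> V (X, b)"
    "\<And>Y. snd p \<le> Y \<Longrightarrow> b \<le> Y \<Longrightarrow> f p (X, Y) v = f (X, b) (X, Y) w"
proof -
  have "prod.swap p \<in> prod.swap -` Q" using p by simp
  from swap.left_imageE[OF this v[unfolded lower_image_def], of a] show thesis
    using that by simp blast
qed

lemma subspace_from_below: "r \<in> Q \<Longrightarrow> subspace (from_below B r)"
  unfolding from_below_def by (rule swap.subspace_from_left) simp

lemma from_below_map_in: "q \<in> Q \<Longrightarrow> snd q \<notin> B \<Longrightarrow> le2 q r \<Longrightarrow> v \<in> V q \<Longrightarrow> f q r v \<in> from_below B r"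
  using swap.from_left_map_in[of "prod.swap q" B "prod.swap r" v] by (simp add: from_below_def)

lemma from_below_factor:
  assumes p: "(x, y) \<in> Q" "x \<le> X" "y \<le> Y" and B: "ord_convex B" "y \<in> B" "Y \<in> B"
    and v: "v \<in> from_below B (X, Y)"
  obtains w where "w \<in> V (X, y)" "f (X, y) (X, Y) w = v"
    "\<And>z. z \<in> V (x, y) \<Longrightarrow> f (x, y) (X, y) z = w \<Longrightarrow>
      z \<in> kernel (x, y) (X, y) \<or> (\<exists>b<y. b \<notin> B \<and> z \<in> lower_image (x, y) b)"
proof -
  have "(y, x) \<in> prod.swap -` Q" using p(1) by simp
  from swap.from_left_factor[OF this p(3,2) B] v show thesis
    using that by (simp add: from_below_def lower_image_def swap_kernel) blast
qed

lemma from_outside_Times_subset: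
  assumes r: "r \<in> Q"
  shows "from_outside (A \<times> B) r \<subseteq> {v + w |v w. v \<in> from_left A r \<and> w \<in> from_below B r}"
  unfolding from_outside_def
proof (rule span_minimal)
  show "subspace {v + w |v w. v \<in> from_left A r \<and> w \<in> from_below B r}"
    by (rule subspace_sums[OF subspace_from_left[OF r] subspace_from_below[OF r]])
  have zero: "0 \<in> from_left A r" "0 \<in> from_below B r"
    by (rule subspace_0[OF subspace_from_left[OF r]], rule subspace_0[OF subspace_from_below[OF r]])
  show "(\<Union>q\<in>{q \<in> Q - A \<times> B. le2 q r}. f q r ` V q)
      \<subseteq> {v + w |v w. v \<in> from_left A r \<and> w \<in> from_below B r}"
  proof (intro UN_least image_subsetI)
    fix q v assume q: "q \<in> {q \<in> Q - A \<times> B. le2 q r}" and v: "v \<in> V q"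
    then consider "f q r v \<in> from_left A r" | "f q r v \<in> from_below B r"
      using from_left_map_in[of q A r v] from_below_map_in[of q B r v] by (auto simp: mem_Times_iff)
    then show "f q r v \<in> {v + w |v w. v \<in> from_left A r \<and> w \<in> from_below B r}"
    proof cases
      case 1
      then show ?thesis using zero(2) by (intro CollectI exI[of _ "f q r v"] exI[of _ 0]) simp
    next
      case 2
      then show ?thesis using zero(1) by (intro CollectI exI[of _ 0] exI[of _ "f q r v"]) simp
    qed
  qed
qed

definition birth_block :: "real \<times> real \<Rightarrow> 'v \<Rightarrow> (real \<times> real) set" where
  "birth_block p m = {a. m \<in> left_image p a} \<times> {b. m \<in> lower_image p b}"

lemma up_closed_birth_block_sides:
  assumes "p \<in> Q"
  shows "up_closed {a. m \<in> left_image p a}" "up_closed {b. m \<in> lower_image p b}"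
  using left_image_mono[OF assms] lower_image_mono[OF assms] unfolding up_closed_def by blast+

lemma in_birth_block: "p \<in> Q \<Longrightarrow> m \<in> V p \<Longrightarrow> p \<in> birth_block p m"
  by (simp add: birth_block_def mem_Times_iff left_image_full lower_image_full)

lemma birth_block_upward: "p \<in> Q \<Longrightarrow> q \<in> birth_block p m \<Longrightarrow> le2 q r \<Longrightarrow> r \<in> birth_block p m"
  using up_closed_birth_block_sides[of p m] up_closedD by (auto simp: birth_block_def mem_Times_iff le2_def)

context
  assumes inj_maps: "\<And>q r. q \<in> Q \<Longrightarrow> le2 q r \<Longrightarrow> inj_on (f q r) (V q)"
begin

lemma kernel_trivial: "q \<in> Q \<Longrightarrow> le2 q r \<Longrightarrow> kernel q r = {0}"
  using inj_onD[OF inj_maps, of q r _ 0] by (auto simp: kernel_def)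

lemma compatibleI_above:
  assumes "q \<in> Q" "r \<in> Q" "u \<in> V q" "w \<in> V r" "le2 q t" "le2 r t" "f q t u = f r t w"
  shows "compatible q u r w"
proof -
  let ?j = "join q r"
  have j: "?j \<in> Q" "le2 ?j t" using assms upward[of q ?j] by (simp_all add: join_le2_iff)
  have "f ?j t (f q ?j u) = f ?j t (f r ?j w)"
    using assms j(2) by (simp add: map_comp)
  then show ?thesis
    unfolding compatible_def using inj_onD[OF inj_maps[OF j]] assms(1-4) map_in by simp
qed

lemma compatible_exists_on_birth_block:
  assumes p: "p \<in> Q" and m: "m \<in> V p" and q: "q \<in> birth_block p m" "q \<in> Q"
  shows "\<exists>z\<in>V q. compatible q z p m"
proof -
  obtain a b where ab: "q = (a, b)" "m \<in> left_image p a" "m \<in> lower_image p b"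
    using q(1) by (auto simp: birth_block_def)
  obtain Y u where Y: "b \<le> Y" "snd p \<le> Y" "(a, Y) \<in> Q" "u \<in> V (a, Y)"
    "\<And>X. fst p \<le> X \<Longrightarrow> a \<le> X \<Longrightarrow> f p (X, Y) m = f (a, Y) (X, Y) u"
    using left_imageE[OF p ab(2), of b] by metis
  obtain X w where X: "a \<le> X" "fst p \<le> X" "(X, b) \<in> Q" "w \<in> V (X, b)"
    "\<And>Y. snd p \<le> Y \<Longrightarrow> b \<le> Y \<Longrightarrow> f p (X, Y) m = f (X, b) (X, Y) w"
    using lower_imageE[OF p ab(3), of a] by metis
  have abQ: "(a, b) \<in> Q" using q(2) ab(1) by simp
  have "f (a, Y) (X, Y) u = f (X, b) (X, Y) w"
    using Y(5)[OF X(2,1)] X(5)[OF Y(2,1)] by simp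
  then obtain z where z: "z \<in> V (a, b)" "f (a, b) (a, Y) z = u"
    using exact[OF abQ X(1) Y(1,4) X(4)] by blast
  have "f (a, b) (X, Y) z = f p (X, Y) m"
    using map_comp[OF abQ, of "(a, Y)" "(X, Y)" z] z X(1) Y(1) Y(5)[OF X(2,1)] by simp
  then have "compatible (a, b) z p m"
    using abQ p z(1) m X(1,2) Y(1,2) by (intro compatibleI_above[of _ _ _ _ "(X, Y)"]) (auto simp: le2_def)
  then show ?thesis using z(1) ab(1) by blast
qed

lemma birth_section:
  assumes p: "p \<in> Q" and m: "m \<in> V p"
  obtains e where "coherent V (birth_block p m \<inter> Q) e" "e p = m"
proof -
  obtain e where e: "\<And>q. q \<in> birth_block p m \<inter> Q \<Longrightarrow> e q \<in> V q"
    "\<And>q. q \<in> birth_block p m \<inter> Q \<Longrightarrow> compatible q (e q) p m"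
    using compatible_exists_on_birth_block[OF p m] by (metis IntE)
  have "f q r (e q) = e r"
    if q: "q \<in> birth_block p m \<inter> Q" and r: "r \<in> birth_block p m \<inter> Q" "le2 q r" for q r
  proof (rule inj_onD[OF inj_maps])
    let ?j = "join r p"
    have "f r ?j (f q r (e q)) = f q ?j (e q)" using q r e(1)[OF q] by (intro map_comp) auto
    also have "\<dots> = f p ?j m"
      using compatible_above[OF e(2)[OF q] _ p e(1)[OF q] m] q le2_trans[OF r(2)] by simp
    also have "\<dots> = f r ?j (e r)"
      using compatible_above[OF e(2)[OF r(1)] _ p e(1)[OF r(1)] m] r(1) by simp
    finally show "f r ?j (f q r (e q)) = f r ?j (e r)" .
    show "f q r (e q) \<in> V r" using q r(2) e(1)[OF q] by (intro map_in) auto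
  qed (use r e(1) in auto)
  moreover have "e p = m"
    using e[of p] in_birth_block[OF p m] p m by (simp add: compatible_def join_def)
  ultimately show thesis using e(1) by (intro that[of e]) (simp_all add: coherent_def)
qed

lemma not_from_outside_birth_block:
  assumes p: "(x, y) \<in> Q" and m: "m \<in> V (x, y)" "m \<noteq> 0"
    and least: "\<And>a. m \<in> left_image (x, y) a \<or> left_image (x, y) a = {0}"
    and r: "(X, Y) \<in> birth_block (x, y) m" "x \<le> X" "y \<le> Y"
  shows "f (x, y) (X, Y) m \<notin> from_outside (birth_block (x, y) m) (X, Y)"
proof
  define A where "A = {a. m \<in> left_image (x, y) a}"
  define B where "B = {b. m \<in> lower_image (x, y) b}"
  have AB: "birth_block (x, y) m = A \<times> B" by (simp add: birth_block_def A_def B_def)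
  have convex: "ord_convex A" "ord_convex B"
    unfolding A_def B_def by (rule up_closed_imp_ord_convex[OF up_closed_birth_block_sides(1)[OF p]],
        rule up_closed_imp_ord_convex[OF up_closed_birth_block_sides(2)[OF p]])
  have in_AB: "x \<in> A" "y \<in> B" "X \<in> A" "Y \<in> B" using in_birth_block[OF p m(1)] r(1) AB by auto
  have Q: "(x, Y) \<in> Q" "(X, y) \<in> Q" "(X, Y) \<in> Q" using upward[OF p] r(2,3) by auto
  assume "f (x, y) (X, Y) m \<in> from_outside (birth_block (x, y) m) (X, Y)"
  then obtain v w where vw: "f (x, y) (X, Y) m = v + w" "v \<in> from_left A (X, Y)" "w \<in> from_below B (X, Y)"
    using from_outside_Times_subset[OF Q(3), of A B] AB by auto
  obtain v' where v': "v' \<in> V (x, Y)" "f (x, Y) (X, Y) v' = v" and from_left: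
    "\<And>z. z \<in> V (x, y) \<Longrightarrow> f (x, y) (x, Y) z = v' \<Longrightarrow>
      z \<in> kernel (x, y) (x, Y) \<or> (\<exists>a<x. a \<notin> A \<and> z \<in> left_image (x, y) a)"
    using from_left_factor[OF p r(2,3) convex(1) in_AB(1,3) vw(2)] by metis
  obtain w' where w': "w' \<in> V (X, y)" "f (X, y) (X, Y) w' = w" and from_below:
    "\<And>z. z \<in> V (x, y) \<Longrightarrow> f (x, y) (X, y) z = w' \<Longrightarrow>
      z \<in> kernel (x, y) (X, y) \<or> (\<exists>b<y. b \<notin> B \<and> z \<in> lower_image (x, y) b)"
    using from_below_factor[OF p r(2,3) convex(2) in_AB(2,4) vw(3)] by metis
  have m': "f (x, y) (X, y) m \<in> V (X, y)" using map_in[OF p _ m(1)] r(2) by simp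
  have "f (x, Y) (X, Y) v' = f (X, y) (X, Y) (f (x, y) (X, y) m - w')"
    using vw(1) v'(2) w' m' p m(1) Q(2) r(2,3) by (simp add: map_diff map_comp)
  then obtain z where z: "z \<in> V (x, y)" "f (x, y) (x, Y) z = v'"
    "f (x, y) (X, y) z = f (x, y) (X, y) m - w'"
    using exact[OF p r(2,3) v'(1) diff_in[OF Q(2) m' w'(1)]] by blast
  have "z = 0"
    using from_left[OF z(1,2)] kernel_trivial[OF p, of "(x, Y)"] least r(3) by (auto simp: A_def)
  then have "f (x, y) (X, y) m = w'" using z(3) p r(2) by simp
  then show False
    using from_below[OF m(1)] kernel_trivial[OF p, of "(X, y)"] m(2) r(2) by (auto simp: B_def)
qed

lemma block_summand_if_injective:
  assumes p: "p \<in> Q" and v: "v \<in> V p" "v \<noteq> 0"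
  shows "\<exists>t. block_summand t"
proof -
  have nonzero: "left_image p (fst p) \<noteq> {0}" using left_image_full[OF p order_refl] v by auto
  obtain m where m: "m \<in> V p" "m \<noteq> 0" and least: "\<And>a. m \<in> left_image p a \<or> left_image p a = {0}"
  proof (rule exists_in_least_nonzero[OF p, of "left_image p" "fst p"])
    show "left_image p a \<subseteq> V p" for a using left_image_in by blast
    show "left_image p a \<subseteq> left_image p b \<or> left_image p b \<subseteq> left_image p a" for a b
      using left_image_mono[OF p, of a b] left_image_mono[OF p, of b a] linear[of a b] by blast
  qed (rule nonzero subspace_left_image[OF p] that left_image_in | assumption)+
  obtain A B where AB: "birth_block p m = A \<times> B" "up_closed A" "up_closed B"
    using up_closed_birth_block_sides[OF p] by (metis birth_block_def)
  have pAB: "p \<in> A \<times> B" using in_birth_block[OF p m(1)] AB(1) by simp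
  obtain e where e: "coherent V (A \<times> B \<inter> Q) e" "e p = m"
    using birth_section[OF p m(1)] AB(1) by metis
  show ?thesis
  proof (rule block_summand_if_not_from_outside[OF _ _ e(1)])
    show "is_block (A \<times> B)" using pAB AB(2,3) by (intro is_block_TimesI) auto
    show "p \<in> A \<times> B \<inter> Q" using pAB p by blast
    show "f q r (e q) = 0" if "q \<in> A \<times> B \<inter> Q" "le2 q r" "r \<notin> A \<times> B" for q r
      using birth_block_upward[OF p _ that(2), of m] that AB(1) by blast
    show "f p r (e p) \<notin> from_outside (A \<times> B) r" if "r \<in> A \<times> B" "le2 p r" for r
      using not_from_outside_birth_block[of "fst p" "snd p" m "fst r" "snd r"] p m least that e(2) AB(1)
      by (simp add: le2_def)
  qed
qed

end

end

section \<open>Decomposition into blocks\<close>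

context middle_exact_module
begin

interpretation swap: middle_exact_module s "prod.swap -` Q" "V \<circ> prod.swap" "swap_maps f"
  by (rule swap_module)

lemma inj_on_map_if_directions_injective:
  assumes h: "\<And>q w. q \<in> Q \<Longrightarrow> w \<in> hdying q \<Longrightarrow> w = 0" and v: "\<And>q w b. q \<in> Q \<Longrightarrow> w \<in> vkernel q b \<Longrightarrow> w = 0"
    and q: "q \<in> Q" "le2 q r"
  shows "inj_on (f q r) (V q)"
proof (rule inj_onI)
  fix u w assume uw: "u \<in> V q" "w \<in> V q" "f q r u = f q r w"
  let ?q = "(fst r, snd q)"
  have le: "le2 q ?q" "le2 ?q r" using q(2) by (auto simp: le2_def)
  have d: "u - w \<in> V q" using q(1) uw by (intro diff_in)
  have "f q ?q (u - w) \<in> vkernel ?q (snd r)"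
    using q d uw le map_comp[OF q(1) le d] map_in[OF q(1) le(1) d]
    by (simp add: vkernel_def kernel_def map_diff max_absorb2 le2_def)
  then have "f q ?q (u - w) = 0" using v upward[OF q(1) le(1)] by blast
  then have "u - w \<in> hdying q" using hdyingI[of "u - w" "fst q" "snd q" "fst r"] d le by (simp add: le2_def)
  then show "u = w" using h[OF q(1)] by fastforce
qed

theorem block_summand_exists:
  assumes p: "p \<in> Q" and v: "v \<in> V p" "v \<noteq> 0"
  shows "\<exists>t. block_summand t"
proof (rule ccontr)
  assume none: "\<nexists>t. block_summand t"
  then have swap_none: "\<nexists>t. swap.block_summand t" using block_summand_swap by blast
  have no_double: "w = 0" if "q \<in> Q" "w \<in> hdying q" "w \<in> vkernel q b" for q w b
    using block_summand_if_doubly_dying[OF that(1)] that none by (auto simp: hdying_def)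
  have h_inj: "w = 0" if "q \<in> Q" "w \<in> hdying q" for q w
  proof (rule ccontr)
    assume "w \<noteq> 0"
    then have "\<exists>t. block_summand t"
      using no_double that by (intro block_summand_if_horizontally_dying)
    then show False using none by contradiction
  qed
  have swap_no_double: "w = 0" if "q \<in> prod.swap -` Q" "w \<in> swap.hdying q" "w \<in> swap.vkernel q b" for q w b
  proof -
    have "w \<in> hdying (prod.swap q)"
      using that(3) by (auto simp: hdying_def hkernel_def swap.vkernel_def swap_kernel)
    then show ?thesis using h_inj[of "prod.swap q"] that(1) by simp
  qed
  have v_inj: "w = 0" if "q \<in> Q" "w \<in> vkernel q b" for q w b
  proof (rule ccontr)
    assume "w \<noteq> 0"
    have "prod.swap q \<in> prod.swap -` Q" "w \<in> swap.hdying (prod.swap q)"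
      using that by (auto simp: swap.hdying_def swap_hkernel)
    then have "\<exists>t. swap.block_summand t"
      using swap_no_double \<open>w \<noteq> 0\<close> by (intro swap.block_summand_if_horizontally_dying)
    then show False using swap_none by contradiction
  qed
  have "inj_on (f q r) (V q)" if "q \<in> Q" "le2 q r" for q r
    by (rule inj_on_map_if_directions_injective[OF h_inj v_inj that])
  then have "\<exists>t. block_summand t" using p v by (intro block_summand_if_injective)
  then show False using none by contradiction
qed

lemma middle_exact_common_kernel:
  assumes "orthogonal_summands s le2 Q V f \<F>"
  shows "middle_exact_module s Q (orthogonal_summands.common_kernel V \<F>) f"
proof -
  interpret orthogonal_summands s le2 Q V f \<F> by fact
  show ?thesis
  proof unfold_locales
    show "\<exists>c. (\<forall>x. (x, c - x) \<in> Q) \<and> (\<forall>q\<in>F. c \<le> fst q + snd q)" if "finite F" "F \<subseteq> Q" for F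
      using that by (rule antidiagonal)
    fix x y x' y' u w
    assume p: "(x, y) \<in> Q" "x \<le> x'" "y \<le> y'"
      and uw: "u \<in> common_kernel (x, y')" "w \<in> common_kernel (x', y)"
      and "f (x, y') (x', y') u = f (x', y) (x', y') w"
    then obtain z where z: "z \<in> V (x, y)" "f (x, y) (x, y') z = u" "f (x, y) (x', y) z = w"
      using exact[OF p] common_kernel_in by blast
    have "f (x, y) (x, y') (projection (x, y) z) = u" "f (x, y) (x', y) (projection (x, y) z) = w"
      using p z uw by (simp_all add: map_projection)
    then show "\<exists>z\<in>common_kernel (x, y). f (x, y) (x, y') z = u \<and> f (x, y) (x', y) z = w"
      using projection_in_common_kernel[OF p(1) z(1)] by blast
  qed
qed

end

lemma iso_to_dsum_coordinates:
  fixes s :: "'k::field \<Rightarrow> 'v::ab_group_add \<Rightarrow> 'v" and I :: "'i set"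
  assumes "complete_orthogonal_summands s le2 Q V f \<F>" and \<tau>: "bij_betw \<tau> I \<F>"
  shows "iso_to_dsum s Q V f I (shape \<circ> \<tau>)"
proof -
  interpret complete_orthogonal_summands s le2 Q V f \<F> by fact
  have dsum_space: "dsum_space Q I (shape \<circ> \<tau>) p = {c :: 'i \<Rightarrow> 'k. \<forall>i. c i \<noteq> 0 \<longrightarrow> i \<in> I \<and> p \<in> shape (\<tau> i)}"
    if p: "p \<in> Q" for p
  proof (rule set_eqI)
    fix c :: "'i \<Rightarrow> 'k"
    have "finite {i. c i \<noteq> 0}" if "\<forall>i. c i \<noteq> 0 \<longrightarrow> i \<in> I \<and> p \<in> shape (\<tau> i)"
      using that by (intro finite_subset[OF _ finite_indices_at[OF \<tau> p]]) blast
    then show "c \<in> dsum_space Q I (shape \<circ> \<tau>) p \<longleftrightarrow> c \<in> {c. \<forall>i. c i \<noteq> 0 \<longrightarrow> i \<in> I \<and> p \<in> shape (\<tau> i)}"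
      using p by (auto simp: dsum_space_def)
  qed
  show ?thesis
    unfolding iso_to_dsum_def
  proof (intro exI[of _ "coordinates I \<tau>"] conjI ballI allI impI)
    fix p assume p: "p \<in> Q"
    show "bij_betw (coordinates I \<tau> p) (V p) (dsum_space Q I (shape \<circ> \<tau>) p)"
      unfolding dsum_space[OF p] by (rule bij_betw_coordinates[OF \<tau> p])
    show "coordinates I \<tau> p (v + w) i = coordinates I \<tau> p v i + coordinates I \<tau> p w i"
      if "v \<in> V p" "w \<in> V p" for v w i
      using coordinates_add[OF \<tau> p that] .
    show "coordinates I \<tau> p (s a v) i = a * coordinates I \<tau> p v i" if "v \<in> V p" for a v i
      using coordinates_scale[OF \<tau> p that] .
    show "coordinates I \<tau> q (f p q v) = dsum_map Q (shape \<circ> \<tau>) p q (coordinates I \<tau> p v)"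
      if "q \<in> Q" "le2 p q" "v \<in> V p" for q v
      using coordinates_map[OF \<tau> p that(2,3)] that(1) by (auto simp: dsum_map_def)
  qed
qed

theorem (in middle_exact_module) block_decomposable: "block_decomposable s Q V f"
proof -
  let ?\<J> = "{J. is_block J \<and> J \<inter> Q \<noteq> {}}"
  obtain \<F> where \<F>: "orthogonal_summands s le2 Q V f \<F>" "shape ` \<F> \<subseteq> ?\<J>"
    "\<And>p v. p \<in> Q \<Longrightarrow> v \<in> orthogonal_summands.common_kernel V \<F> p \<Longrightarrow> v = 0"
  proof (rule complete_orthogonal_summands[of ?\<J>])
    fix \<F> p v
    assume "orthogonal_summands s le2 Q V f \<F>" "p \<in> Q" "v \<in> orthogonal_summands.common_kernel V \<F> p" "v \<noteq> 0"
    then show "\<exists>t. persistence_module.is_summand s le2 Q (orthogonal_summands.common_kernel V \<F>) f t \<and>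
        shape t \<in> ?\<J>"
      using middle_exact_module.block_summand_exists[OF middle_exact_common_kernel]
      by (simp add: middle_exact_module.block_summand_def[OF middle_exact_common_kernel])
  qed (use that in auto)
  then interpret complete_orthogonal_summands s le2 Q V f \<F>
    by (intro complete_orthogonal_summands.intro complete_orthogonal_summands_axioms.intro)
  obtain \<kappa> :: "_ \<Rightarrow> (real \<times> real) \<times> nat" where "inj_on \<kappa> \<F>"
    using index_by_points \<F>(2) by blast
  then have "inj_on (\<lambda>t. case \<kappa> t of ((x, y), n) \<Rightarrow> (x, y, n)) \<F>"
    by (auto simp: inj_on_def split: prod.splits)
  then obtain \<iota> :: "_ \<Rightarrow> real \<times> real \<times> nat" where \<iota>: "inj_on \<iota> \<F>" by blast
  have \<tau>: "bij_betw (inv_into \<F> \<iota>) (\<iota> ` \<F>) \<F>"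
    using \<iota> by (intro bij_betw_inv_into inj_on_imp_bij_betw)
  have "iso_to_dsum s Q V f (\<iota> ` \<F>) (shape \<circ> inv_into \<F> \<iota>)"
    by (rule iso_to_dsum_coordinates[OF complete_orthogonal_summands_axioms \<tau>])
  moreover have "(shape \<circ> inv_into \<F> \<iota>) i \<in> ?\<J>" if "i \<in> \<iota> ` \<F>" for i
    using bij_betw_apply[OF \<tau> that] \<F>(2) by (simp add: image_subset_iff)
  ultimately show ?thesis
    unfolding block_decomposable_def
    by (intro exI[of _ "\<iota> ` \<F>"] exI[of _ "shape \<circ> inv_into \<F> \<iota>"]) simp
qed

lemma middle_exact_moduleI:
  assumes "pers_module s Q V f" "pointwise_fin_dim s Q V" "middle_exact Q V f"
    and upward: "\<And>p q. p \<in> Q \<Longrightarrow> le2 p q \<Longrightarrow> q \<in> Q"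
    and antidiagonal: "\<And>F. finite F \<Longrightarrow> F \<subseteq> Q \<Longrightarrow> \<exists>c. (\<forall>x. (x, c - x) \<in> Q) \<and> (\<forall>q\<in>F. c \<le> fst q + snd q)"
  shows "middle_exact_module s Q V f"
proof -
  interpret vector_space s using assms(1) by (simp add: pers_module_def)
  note pers = assms(1)[unfolded pers_module_def]
  show ?thesis
  proof unfold_locales
    show "\<exists>B. finite B \<and> V p \<subseteq> span B" if "p \<in> Q" for p
      using assms(2) that unfolding pointwise_fin_dim_def by (metis order_refl)
    fix x y x' y' u w
    assume p: "(x, y) \<in> Q" "x \<le> x'" "y \<le> y'" and uw: "u \<in> V (x, y')" "w \<in> V (x', y)"
      "f (x, y') (x', y') u = f (x', y) (x', y') w"
    have "(x, y') \<in> Q" "(x', y) \<in> Q" "(x', y') \<in> Q" using upward[OF p(1)] p(2,3) by auto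
    then show "\<exists>z\<in>V (x, y). f (x, y) (x, y') z = u \<and> f (x, y) (x', y) z = w"
      using assms(3)[unfolded middle_exact_def, rule_format, of x x' y y' u w] p uw by simp
  next
    fix p q v w a assume p: "p \<in> Q" "le2 p q" and v: "v \<in> V p"
    have "q \<in> Q" using upward[OF p] .
    then show "f p q v \<in> V q" "f p q (s a v) = s a (f p q v)" using pers p v by blast+
    show "f p q (v + w) = f p q v + f p q w" if "w \<in> V p" using pers p v \<open>q \<in> Q\<close> that by blast
    show "f q r (f p q v) = f p r v" if "le2 q r" for r
      using pers p v \<open>q \<in> Q\<close> upward[OF \<open>q \<in> Q\<close> that] that by blast
  next
    show "subspace (V p)" if "p \<in> Q" for p using pers that by blast
    show "f p p v = v" if "p \<in> Q" "v \<in> V p" for p v using pers that by blast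
  qed (rule le2_refl | rule le2_trans upward antidiagonal, assumption+)+
qed

lemma middle_exact_module_T_open:
  assumes "pers_module s T_open V f" "pointwise_fin_dim s T_open V" "middle_exact T_open V f"
  shows "middle_exact_module s T_open V f"
proof (rule middle_exact_moduleI[OF assms])
  show "q \<in> T_open" if "p \<in> T_open" "le2 p q" for p q
    using that by (cases p, cases q) (simp add: T_open_def)
  fix F assume F: "finite F" "F \<subseteq> T_open"
  define c where "c = Min (insert 1 ((\<lambda>q. fst q + snd q) ` F))"
  have "c > 0" unfolding c_def using F by (auto simp: T_open_def)
  moreover have "\<forall>q\<in>F. c \<le> fst q + snd q" unfolding c_def using F(1) by auto
  ultimately show "\<exists>c. (\<forall>x. (x, c - x) \<in> T_open) \<and> (\<forall>q\<in>F. c \<le> fst q + snd q)"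
    by (intro exI[of _ c]) (simp add: T_open_def)
qed

lemma middle_exact_module_T_closed:
  assumes "pers_module s T_closed V f" "pointwise_fin_dim s T_closed V" "middle_exact T_closed V f"
  shows "middle_exact_module s T_closed V f"
proof (rule middle_exact_moduleI[OF assms])
  show "q \<in> T_closed" if "p \<in> T_closed" "le2 p q" for p q
    using that by (cases p, cases q) (simp add: T_closed_def)
  show "\<exists>c. (\<forall>x. (x, c - x) \<in> T_closed) \<and> (\<forall>q\<in>F. c \<le> fst q + snd q)" if "F \<subseteq> T_closed" for F
    using that by (intro exI[of _ 0]) (auto simp: T_closed_def)
qed

theorem theorem1p4:
  shows "(\<forall>(s :: 'k::field \<Rightarrow> 'v::ab_group_add \<Rightarrow> 'v) V f.
            pers_module s T_open V f \<and> pointwise_fin_dim s T_open V \<and> middle_exact T_open V f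
              \<longrightarrow> block_decomposable s T_open V f) \<and>
         (\<forall>(s :: 'k::field \<Rightarrow> 'v::ab_group_add \<Rightarrow> 'v) V f.
            pers_module s T_closed V f \<and> pointwise_fin_dim s T_closed V \<and> middle_exact T_closed V f
              \<longrightarrow> block_decomposable s T_closed V f)"
  using middle_exact_module.block_decomposable[OF middle_exact_module_T_open]
    middle_exact_module.block_decomposable[OF middle_exact_module_T_closed] by blast

end
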